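(* Let $N\ge1$. For any $u\in\mathfrak{A}_1^1$ and $v\in\mathfrak{A}_N^1$, we have $$\zeta_{\sqcup\!\sqcup}^{\mathcal{S}}(u\sqcup\!\sqcup v)=\zeta_{\sqcup\!\sqcup}^{\mathcal{S}}(\tau(u)v),$$ where $\tau(u)v$ is the concatenation product.
   Context: $\mathbb{N}$ denotes the positive integers, $\Gamma_N\subset\mathbb{C}$ the group of $N$th roots of unity. Colored multiple zeta values: $\zeta\binom{\mathbf{s}}{\boldsymbol\eta}:=\sum_{k_1>\cdots>k_d>0}\frac{\eta_1^{k_1}\cdots\eta_d^{k_d}}{k_1^{s_1}\cdots k_d^{s_d}}$ for $\mathbf{s}\in\mathbb{N}^d$, $\boldsymbol\eta\in\Gamma_N^d$ with $(s_1,\eta_1)\ne(1,1)$ (limit of the partial sums over $k_1\le n$). Words: $\mathfrak{A}_N=\mathbb{Q}\langle x_\eta:\eta\in\Gamma_N\cup\{0\}\rangle$; $\mathfrak{A}_N^1$ is the span of words not ending in $x_0$, freely generated by $y_{m,\mu}:=x_0^{m-1}x_\mu$ ($m\in\mathbb{N},\mu\in\Gamma_N$); $\mathfrak{A}_N^0\subset\mathfrak{A}_N^1$ is the span of words that moreover do not begin with $x_1$; $\mathfrak{A}_1^1\subset\mathfrak{A}_N^1$ is the span of words in $x_0,x_1$ only that do not end in $x_0$; $1$ is the empty word. The shuffle product $\sqcup\!\sqcup$ on $\mathfrak{A}_N$: bilinear, $1\sqcup\!\sqcup w=w\sqcup\!\sqcup1=w$, $au\sqcup\!\sqcup bv=a(u\sqcup\!\sqcup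 bv)+b(au\sqcup\!\sqcup v)$ for letters $a,b$. The linear map $\tau\colon\mathfrak{A}_1^1\to\mathfrak{A}_1^1$ is $\tau(1)=1$, $\tau(x_0^{s_1-1}x_1\cdots x_0^{s_d-1}x_1)=(-1)^{s_1+\cdots+s_d}x_0^{s_d-1}x_1\cdots x_0^{s_1-1}x_1$. Regularization (known fact): the $\mathbb{Q}$-linear map $\mathfrak{A}_N^0\to\mathbb{C}$, $y_{s_1,\eta_1}\cdots y_{s_d,\eta_d}\mapsto\zeta\binom{s_1,\,s_2,\dots,\,s_d}{\eta_1,\,\eta_2/\eta_1,\dots,\,\eta_d/\eta_{d-1}}$, $1\mapsto1$, is an algebra homomorphism for $\sqcup\!\sqcup$ and extends uniquely to an algebra homomorphism $\zeta_{\sqcup\!\sqcup}(-;T)\colon(\mathfrak{A}_N^1,\sqcup\!\sqcup)\to\mathbb{C}[T]$ with $\zeta_{\sqcup\!\sqcup}(x_1;T)=T$. Put $\zeta_{\sqcup\!\sqcup}\big(\begin{smallmatrix}\mathbf{s}\\ \boldsymbol\eta\end{smallmatrix}\big|T\big):=\zeta_{\sqcup\!\sqcup}(y_{s_1,\eta_1}y_{s_2,\eta_1\eta_2}\cdots y_{s_d,\eta_1\cdots\eta_d};T)$ (value $1$ for $d=0$). Symmetrized values: $$\zeta_{\sqcup\!\sqcup}^{\mathcal{S}}\binom{\mathbf{s}}{\boldsymbol\eta}:=\sum_{j=0}^d(-1)^{s_1+\cdots+s_j}\,\overline{\eta_1}\cdots\overline{\eta_j}\;\zeta_{\sqcup\!\sqcup}\Big(\begin{smallmatrix}s_j,\dots,s_1\\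 \overline{\eta_j},\dots,\overline{\eta_1}\end{smallmatrix}\Big|T\Big)\,\zeta_{\sqcup\!\sqcup}\Big(\begin{smallmatrix}s_{j+1},\dots,s_d\\ \eta_{j+1},\dots,\eta_d\end{smallmatrix}\Big|T\Big),$$ which is known to be independent of $T$. The $\mathbb{Q}$-linear map $\zeta_{\sqcup\!\sqcup}^{\mathcal{S}}\colon\mathfrak{A}_N^1\to\mathbb{C}$ is defined on words by $\zeta_{\sqcup\!\sqcup}^{\mathcal{S}}(y_{s_1,\eta_1}\cdots y_{s_d,\eta_d}):=\zeta_{\sqcup\!\sqcup}^{\mathcal{S}}\binom{s_1,\,s_2,\dots,\,s_d}{\eta_1,\,\eta_2/\eta_1,\dots,\,\eta_d/\eta_{d-1}}$, and $1\mapsto1$. *)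

theory Defs
  imports
    Complex_Main
    "HOL-Library.Poly_Mapping"
    "HOL-Computational_Algebra.Polynomial"
begin

section \<open>Words and noncommutative polynomials\<close>

text \<open>
  The letter \<open>x\<^sub>\<eta>\<close> is encoded by the complex number \<open>\<eta>\<close> itself, where \<open>\<eta>\<close> is \<open>0\<close> or a root of
  unity.  Lists become a monoid under concatenation, so that the finitely supported functions
  \<open>complex list \<Rightarrow>\<^sub>0 rat\<close>, with the convolution product of \<^theory>\<open>HOL-Library.Poly_Mapping\<close>, form
  the free associative algebra: \<open>*\<close> is the concatenation product and \<open>1\<close> is the empty word.
\<close>

instantiation list :: (type) monoid_add
begin

definition zero_list :: "'a list" where "0 = []"

definition plus_list :: "'a list \<Rightarrow> 'a list \<Rightarrow> 'a list" where "u + v = u @ v"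

instance by standard (simp_all add: zero_list_def plus_list_def)

end

type_synonym ncpoly = "complex list \<Rightarrow>\<^sub>0 rat"

definition word :: "complex list \<Rightarrow> ncpoly" where
  "word w = Poly_Mapping.single w 1"

abbreviation letter :: "complex \<Rightarrow> ncpoly" where
  "letter \<eta> \<equiv> word [\<eta>]"

definition scale :: "rat \<Rightarrow> ncpoly \<Rightarrow> ncpoly" where
  "scale c f = Poly_Mapping.map ((*) c) f"

lemma word_Nil: "word [] = 1"
  by (simp add: word_def single_one flip: zero_list_def)

lemma word_append: "word (u @ v) = word u * word v"
  by (simp add: word_def mult_single plus_list_def)

lemma lookup_scale: "Poly_Mapping.lookup (scale c f) w = c * Poly_Mapping.lookup f w"
  by (simp add: scale_def map.rep_eq when_def)

definition roots_of_unity :: "nat \<Rightarrow> complex set" where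
  "roots_of_unity N = {\<eta>. \<eta> ^ N = 1}"

definition words1 :: "nat \<Rightarrow> complex list set" where
  "words1 N = {w. set w \<subseteq> insert 0 (roots_of_unity N) \<and> (w \<noteq> [] \<longrightarrow> last w \<noteq> 0)}"

definition words0 :: "nat \<Rightarrow> complex list set" where
  "words0 N = {w \<in> words1 N. w \<noteq> [] \<longrightarrow> hd w \<noteq> 1}"

definition A1 :: "nat \<Rightarrow> ncpoly set" where
  "A1 N = {f. Poly_Mapping.keys f \<subseteq> words1 N}"

text \<open>Bilinear extension of the shuffle product of two words (with multiplicities).\<close>

fun shuffle_words :: "complex list \<Rightarrow> complex list \<Rightarrow> ncpoly" where
  "shuffle_words [] v = word v"
| "shuffle_words u [] = word u"
| "shuffle_words (a # u) (b # v) =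
     letter a * shuffle_words u (b # v) + letter b * shuffle_words (a # u) v"

definition shuffle :: "ncpoly \<Rightarrow> ncpoly \<Rightarrow> ncpoly" where
  "shuffle f g = (\<Sum>u\<in>Poly_Mapping.keys f. \<Sum>v\<in>Poly_Mapping.keys g.
     scale (Poly_Mapping.lookup f u * Poly_Mapping.lookup g v) (shuffle_words u v))"


section \<open>Words in the letters \<open>y\<^sub>m\<^sub>,\<^sub>\<mu>\<close>\<close>

text \<open>
  An index \<open>((s\<^sub>1,\<eta>\<^sub>1), \<dots>, (s\<^sub>d,\<eta>\<^sub>d))\<close> is a list of pairs.  \<open>yword\<close> turns it into the word
  \<open>y\<^bsub>s1,\<eta>1\<^esub> \<cdots> y\<^bsub>sd,\<eta>d\<^esub>\<close>, where \<open>y\<^sub>m\<^sub>,\<^sub>\<mu> = x\<^sub>0\<^sup>m\<^sup>-\<^sup>1 x\<^sub>\<mu>\<close>; \<open>yindex\<close> is its inverse on words not ending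
  in \<open>x\<^sub>0\<close>.
\<close>

type_synonym index = "(nat \<times> complex) list"

definition indices :: "nat \<Rightarrow> index set" where
  "indices N = {ps. \<forall>(s, \<eta>)\<in>set ps. 1 \<le> s \<and> \<eta> \<in> roots_of_unity N}"

definition yword :: "index \<Rightarrow> complex list" where
  "yword ps = concat (map (\<lambda>(m, \<mu>). replicate (m - 1) 0 @ [\<mu>]) ps)"

text \<open>The first argument counts the letters \<open>x\<^sub>0\<close> read since the last letter \<open>x\<^sub>\<mu>\<close> with \<open>\<mu> \<noteq> 0\<close>.\<close>

fun yindex_from :: "nat \<Rightarrow> complex list \<Rightarrow> index" where
  "yindex_from k [] = []"
| "yindex_from k (a # w) =
     (if a = 0 then yindex_from (Suc k) w else (Suc k, a) # yindex_from 0 w)"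

definition yindex :: "complex list \<Rightarrow> index" where
  "yindex w = yindex_from 0 w"

lemma roots_of_unity_nonzero: "1 \<le> N \<Longrightarrow> \<eta> \<in> roots_of_unity N \<Longrightarrow> \<eta> \<noteq> 0"
  by (auto simp: roots_of_unity_def power_0_left)

lemma word_yword:
  "word (yword ps) = prod_list (map (\<lambda>(m, \<mu>). letter 0 ^ (m - 1) * letter \<mu>) ps)"
proof -
  have "word (replicate k 0) = letter 0 ^ k" for k
  proof (induction k)
    case (Suc k)
    then show ?case using word_append[of "[0]" "replicate k 0"] by simp
  qed (simp add: word_Nil)
  then show ?thesis
    by (induction ps) (auto simp: yword_def word_Nil word_append mult.assoc)
qed

lemma yindex_from_replicate:
  "\<mu> \<noteq> 0 \<Longrightarrow> yindex_from k (replicate m 0 @ \<mu> # w) = (Suc (k + m), \<mu>) # yindex_from 0 w"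
  by (induction m arbitrary: k) auto

lemma yindex_yword:
  assumes "1 \<le> N" "ps \<in> indices N"
  shows "yindex (yword ps) = ps"
  using assms(2)
proof (induction ps)
  case (Cons p ps)
  obtain m \<mu> where p: "p = (m, \<mu>)" by (cases p)
  with Cons.prems have "1 \<le> m" "\<mu> \<noteq> 0" "ps \<in> indices N"
    using roots_of_unity_nonzero[OF assms(1)] by (auto simp: indices_def)
  with Cons.IH show ?case
    by (simp add: p yword_def yindex_def yindex_from_replicate)
qed (simp add: yword_def yindex_def)

lemma yword_yindex_from:
  "(w \<noteq> [] \<longrightarrow> last w \<noteq> 0) \<Longrightarrow> (w = [] \<longrightarrow> k = 0) \<Longrightarrow>
     yword (yindex_from k w) = replicate k 0 @ w"
proof (induction k w rule: yindex_from.induct)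
  case (2 k a w)
  show ?case
  proof (cases "a = 0")
    case True
    with "2.prems" have "w \<noteq> []" "last w \<noteq> 0" by (auto split: if_splits)
    with True "2.IH"(1) show ?thesis
      by (simp add: replicate_append_same flip: append_Cons)
  next
    case False
    with "2.IH"(2) "2.prems" show ?thesis by (auto simp: yword_def split: if_splits)
  qed
qed (simp add: yword_def)

lemma yword_yindex: "w \<in> words1 N \<Longrightarrow> yword (yindex w) = w"
  by (simp add: yindex_def words1_def yword_yindex_from)

text \<open>
  The two mutually inverse reparametrisations
  \<open>(\<eta>\<^sub>1, \<dots>, \<eta>\<^sub>d) \<mapsto> (\<eta>\<^sub>1, \<eta>\<^sub>2/\<eta>\<^sub>1, \<dots>, \<eta>\<^sub>d/\<eta>\<^sub>d\<^sub>-\<^sub>1)\<close> and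
  \<open>(\<eta>\<^sub>1, \<dots>, \<eta>\<^sub>d) \<mapsto> (\<eta>\<^sub>1, \<eta>\<^sub>1\<eta>\<^sub>2, \<dots>, \<eta>\<^sub>1\<cdots>\<eta>\<^sub>d)\<close>, for initial value \<open>1\<close> of the first argument.
\<close>

fun ratios_from :: "complex \<Rightarrow> index \<Rightarrow> index" where
  "ratios_from c [] = []"
| "ratios_from c ((s, \<eta>) # ps) = (s, \<eta> / c) # ratios_from \<eta> ps"

definition ratios :: "index \<Rightarrow> index" where
  "ratios = ratios_from 1"

fun partial_prods_from :: "complex \<Rightarrow> index \<Rightarrow> index" where
  "partial_prods_from c [] = []"
| "partial_prods_from c ((s, \<eta>) # ps) = (s, c * \<eta>) # partial_prods_from (c * \<eta>) ps"

definition partial_prods :: "index \<Rightarrow> index" where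
  "partial_prods = partial_prods_from 1"

text \<open>The sign exponent \<open>s\<^sub>1 + \<cdots> + s\<^sub>d\<close>.\<close>

definition weight :: "index \<Rightarrow> nat" where
  "weight ps = sum_list (map fst ps)"

definition tau :: "ncpoly \<Rightarrow> ncpoly" where
  "tau f = (\<Sum>w\<in>Poly_Mapping.keys f.
     scale (Poly_Mapping.lookup f w * (- 1) ^ weight (yindex w)) (word (yword (rev (yindex w)))))"


section \<open>Colored multiple zeta values and their shuffle regularization\<close>

text \<open>\<open>ks\<close> ranges over the lists \<open>n \<ge> k\<^sub>1 > \<cdots> > k\<^sub>d > 0\<close>.\<close>

definition cmzv_partial :: "index \<Rightarrow> nat \<Rightarrow> complex" where
  "cmzv_partial ps n =
     (\<Sum>ks | length ks = length ps \<and> sorted_wrt (>) ks \<and> set ks \<subseteq> {1..n}.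
        \<Prod>i<length ps. snd (ps ! i) ^ (ks ! i) / of_nat (ks ! i) ^ fst (ps ! i))"

definition cmzv :: "index \<Rightarrow> complex" where
  "cmzv ps = lim (cmzv_partial ps)"

text \<open>
  \<open>is_shuffle_reg N Z\<close>: on \<open>A1 N\<close>, the map \<open>Z\<close> is a homomorphism of \<open>\<rat>\<close>-algebras from the shuffle
  algebra to \<open>\<complex>[T]\<close> that sends \<open>x\<^sub>1\<close> to \<open>T\<close> and extends the convergent values, i.e. those on words
  \<open>y\<^bsub>s1,\<eta>1\<^esub> \<cdots> y\<^bsub>sd,\<eta>d\<^esub>\<close> not beginning with \<open>x\<^sub>1\<close>.  Such a map exists and is unique on \<open>A1 N\<close> (for
  \<open>N \<ge> 1\<close>), so the choice operator in \<open>zeta_sh\<close> only selects irrelevant values outside \<open>A1 N\<close>.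
\<close>

definition is_shuffle_reg :: "nat \<Rightarrow> (ncpoly \<Rightarrow> complex poly) \<Rightarrow> bool" where
  "is_shuffle_reg N Z \<longleftrightarrow>
     (\<forall>f\<in>A1 N. \<forall>g\<in>A1 N. Z (f + g) = Z f + Z g) \<and>
     (\<forall>c. \<forall>f\<in>A1 N. Z (scale c f) = smult (of_rat c) (Z f)) \<and>
     Z 1 = 1 \<and>
     (\<forall>f\<in>A1 N. \<forall>g\<in>A1 N. Z (shuffle f g) = Z f * Z g) \<and>
     Z (letter 1) = [:0, 1:] \<and>
     (\<forall>ps\<in>indices N. yword ps \<in> words0 N \<longrightarrow> Z (word (yword ps)) = [:cmzv (ratios ps):])"

definition zeta_sh :: "nat \<Rightarrow> ncpoly \<Rightarrow> complex poly" where
  "zeta_sh N = (SOME Z. is_shuffle_reg N Z)"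

text \<open>The value at \<open>T\<close> of the regularized colored multiple zeta value of an index.\<close>

definition zeta_sh_index :: "nat \<Rightarrow> complex \<Rightarrow> index \<Rightarrow> complex" where
  "zeta_sh_index N T ps = poly (zeta_sh N (word (yword (partial_prods ps)))) T"


section \<open>Symmetrized values\<close>

text \<open>
  The symmetrized values do not depend on \<open>T\<close>; since \<open>T\<close> occurs in the defining formula, it is kept
  as an explicit parameter.
\<close>

definition zeta_S_index :: "nat \<Rightarrow> complex \<Rightarrow> index \<Rightarrow> complex" where
  "zeta_S_index N T ps =
     (\<Sum>j\<le>length ps.
        (- 1) ^ weight (take j ps) * (\<Prod>i<j. cnj (snd (ps ! i))) *
        zeta_sh_index N T (rev (map (\<lambda>(s, \<eta>). (s, cnj \<eta>)) (take j ps))) *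
        zeta_sh_index N T (drop j ps))"

definition zeta_S :: "nat \<Rightarrow> complex \<Rightarrow> ncpoly \<Rightarrow> complex" where
  "zeta_S N T f = (\<Sum>w\<in>Poly_Mapping.keys f.
     of_rat (Poly_Mapping.lookup f w) * zeta_S_index N T (ratios (yindex w)))"

end

theory Submission
  imports Defs "HOL-Analysis.Analysis"
begin

text \<open>
  The colored multiple zeta values are the values at \<open>1\<close> of power series attached to words, which
  satisfy the differential equation of iterated integrals.  Since the shuffle product is the Leibniz
  rule for this equation, word by word the series form a character of the shuffle algebra.  As
  \<open>z\<close> tends to \<open>1\<close>, each series agrees up to faster than polynomial decay in \<open>t = - log (1 - z)\<close> with a
  unique polynomial in \<open>t\<close>; this polynomial is the shuffle regularization, which is unique because a
  word with leading letters \<open>x\<^sub>1\<close> is reduced to words with fewer of them by shuffling with \<open>x\<^sub>1\<close>.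

  Cutting \<open>x\<^sub>1 w\<close> at each letter \<open>x\<^sub>a\<close> with \<open>a \<noteq> 0\<close> turns the symmetrized value of \<open>w\<close> into the coefficient
  of \<open>x\<^sub>1 w\<close> in the sum of \<open>a\<^sup>-\<^sup>1 \<Phi>\<^sub>a\<^sup>-\<^sup>1 x\<^sub>a \<Phi>\<^sub>a\<close> over \<open>a\<close>, where \<open>\<Phi>\<^sub>a\<close> is the group-like generating series of
  the regularized values with all letters divided by \<open>a\<close>.  This is a Lie series, so it kills the shuffles
  of two nonempty words.  Applied to \<open>x\<^sub>0\<^sup>j x\<^sub>1 u\<close> and \<open>x\<^sub>0\<^sup>k x\<^sub>1 v\<close> with \<open>j + k\<close> fixed, this moves one block
  \<open>x\<^sub>0\<^sup>s\<^sup>-\<^sup>1 x\<^sub>1\<close> from the front of the left factor to the front of the right one, with the sign \<open>(-1)\<^sup>s\<close>.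
\<close>

section \<open>Sums over shuffles\<close>

text \<open>The shuffle product is handled through its pairing with an arbitrary function \<phi>,
  each shuffle counted with its multiplicity. Values in any commutative monoid are allowed, so that
  power series, polynomials and numbers are covered at once.\<close>

fun shuf_sum :: "('a list \<Rightarrow> 'b::comm_monoid_add) \<Rightarrow> 'a list \<Rightarrow> 'a list \<Rightarrow> 'b" where
  "shuf_sum \<phi> [] v = \<phi> v"
| "shuf_sum \<phi> (a # u) [] = \<phi> (a # u)"
| "shuf_sum \<phi> (a # u) (b # v) =
     shuf_sum (\<lambda>w. \<phi> (a # w)) u (b # v) + shuf_sum (\<lambda>w. \<phi> (b # w)) (a # u) v"

lemma shuf_sum_Nil2 [simp]: "shuf_sum \<phi> u [] = \<phi> u"
  by (cases u) auto

lemma shuf_sum_cong: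
  "(\<And>w. w \<in> shuffles u v \<Longrightarrow> \<phi> w = \<psi> w) \<Longrightarrow> shuf_sum \<phi> u v = shuf_sum \<psi> u v"
proof (induction u v arbitrary: \<phi> \<psi> rule: shuffles.induct)
  case (3 a u b v)
  have "shuf_sum (\<lambda>w. \<phi> (a # w)) u (b # v) = shuf_sum (\<lambda>w. \<psi> (a # w)) u (b # v)"
    by (rule "3.IH"(1)) (simp add: "3.prems")
  moreover have "shuf_sum (\<lambda>w. \<phi> (b # w)) (a # u) v = shuf_sum (\<lambda>w. \<psi> (b # w)) (a # u) v"
    by (rule "3.IH"(2)) (simp add: "3.prems")
  ultimately show ?case by simp
qed auto

lemma shuf_sum_add:
  "shuf_sum (\<lambda>w. \<phi> w + \<psi> w) u v = shuf_sum \<phi> u v + shuf_sum \<psi> u v"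
proof (induction u v arbitrary: \<phi> \<psi> rule: shuffles.induct)
  case (3 a u b v)
  show ?case by (simp only: shuf_sum.simps "3.IH") (simp add: ac_simps)
qed auto

lemma shuf_sum_hom:
  assumes "\<And>x y. h (x + y) = h x + h y"
  shows "shuf_sum (\<lambda>w. h (\<phi> w)) u v = h (shuf_sum \<phi> u v)"
proof (induction u v arbitrary: \<phi> rule: shuffles.induct)
  case (3 a u b v)
  show ?case by (simp only: shuf_sum.simps "3.IH" assms)
qed auto

lemma shuf_sum_0 [simp]: "shuf_sum (\<lambda>w. 0) u v = 0"
  by (induction u v rule: shuffles.induct) auto

lemma shuf_sum_diff:
  fixes \<phi> :: "'a list \<Rightarrow> 'b::ab_group_add"
  shows "shuf_sum (\<lambda>w. \<phi> w - \<psi> w) u v = shuf_sum \<phi> u v - shuf_sum \<psi> u v"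
proof (induction u v arbitrary: \<phi> \<psi> rule: shuffles.induct)
  case (3 a u b v)
  show ?case by (simp only: shuf_sum.simps "3.IH") (simp add: algebra_simps)
qed auto

lemma shuf_sum_mult_left:
  fixes \<phi> :: "'a list \<Rightarrow> 'b::semiring_0"
  shows "shuf_sum (\<lambda>w. c * \<phi> w) u v = c * shuf_sum \<phi> u v"
  by (rule shuf_sum_hom) (rule distrib_left)

lemma shuf_sum_mult_right:
  fixes \<phi> :: "'a list \<Rightarrow> 'b::semiring_0"
  shows "shuf_sum (\<lambda>w. \<phi> w * c) u v = shuf_sum \<phi> u v * c"
  by (rule shuf_sum_hom[of "\<lambda>x. x * c"]) (rule distrib_right)

lemma shuf_sum_snoc_single:
  "shuf_sum \<phi> (u @ [a]) [b] = shuf_sum (\<lambda>w. \<phi> (w @ [a])) u [b] + \<phi> (u @ [a, b])"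
  by (induction u arbitrary: \<phi>) (simp_all add: ac_simps)

text \<open>The last letter of a shuffle also comes from one of the two words. This form serves the
  part of the differential equation that removes a final \<open>x\<^sub>0\<close>, and
  reversal.\<close>

lemma shuf_sum_snoc:
  "shuf_sum \<phi> (u @ [a]) (v @ [b]) =
     shuf_sum (\<lambda>w. \<phi> (w @ [a])) u (v @ [b]) + shuf_sum (\<lambda>w. \<phi> (w @ [b])) (u @ [a]) v"
proof (induction u v arbitrary: \<phi> rule: shuffles.induct)
  case (1 v)
  show ?case
    by (induction v arbitrary: \<phi>) (simp_all add: ac_simps)
next
  case (2 u)
  show ?case using shuf_sum_snoc_single[of \<phi> u] by simp
next
  case (3 a' u b' v)
  show ?case by (simp only: append_Cons shuf_sum.simps "3.IH"[unfolded append_Cons]) (simp add: ac_simps)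
qed

lemma shuf_sum_rev: "shuf_sum (\<lambda>w. \<phi> (rev w)) u v = shuf_sum \<phi> (rev u) (rev v)"
proof (induction u v arbitrary: \<phi> rule: shuffles.induct)
  case (3 a u b v)
  show ?case
    using "3"(1)[of "\<lambda>w. \<phi> (w @ [a])"] "3"(2)[of "\<lambda>w. \<phi> (w @ [b])"]
    by (simp add: shuf_sum_snoc)
qed simp_all

lemma shuf_sum_map: "shuf_sum (\<lambda>w. \<phi> (map f w)) u v = shuf_sum \<phi> (map f u) (map f v)"
proof (induction u v arbitrary: \<phi> rule: shuffles.induct)
  case (3 a u b v)
  show ?case
    using "3"(1)[of "\<lambda>w. \<phi> (f a # w)"] "3"(2)[of "\<lambda>w. \<phi> (f b # w)"] by simp
qed simp_all

lemma last_shuffles: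
  "w \<in> shuffles u v \<Longrightarrow> w \<noteq> [] \<Longrightarrow>
     (u \<noteq> [] \<and> last w = last u) \<or> (v \<noteq> [] \<and> last w = last v)"
proof (induction u v arbitrary: w rule: shuffles.induct)
  case (3 x xs y ys)
  from "3.prems"(1) consider
      w' where "w = x # w'" "w' \<in> shuffles xs (y # ys)"
    | w' where "w = y # w'" "w' \<in> shuffles (x # xs) ys" by auto
  then show ?case
  proof cases
    case 1
    then have "w' \<noteq> []" by (metis Nil_in_shuffles list.discI)
    then show ?thesis using "3.IH"(1)[OF 1(2)] 1 by auto
  next
    case 2
    then have "w' \<noteq> []" by (metis Nil_in_shuffles list.discI)
    then show ?thesis using "3.IH"(2)[OF 2(2)] 2 by auto
  qed
qed auto

section \<open>Power series of words\<close>

text \<open>z times the density of the iterated-integral form of the letter: \<open>z / z\<close>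
  for the letter 0, and the expansion of \<open>a z / (1 - a z)\<close> for a \<noteq> 0.\<close>

definition zero_kernel :: "complex \<Rightarrow> complex fps" where
  "zero_kernel a = (if a = 0 then 1 else Abs_fps (\<lambda>n. if n = 0 then 0 else a ^ n))"

text \<open>
  \<open>polylog w\<close> is the solution \<open>M\<close>, with constant term \<open>1\<close> on the empty word, of
  \<open>z M' = (\<Sum>a. zero_kernel a x\<^sub>a) M - M x\<^sub>0\<close>.  The term \<open>M x\<^sub>0\<close> divides out the factor
  \<open>exp (x\<^sub>0 log z)\<close>, so that words ending in \<open>x\<^sub>0\<close> also have a power series, without logarithms.
\<close>

function polylog :: "complex list \<Rightarrow> complex fps" where
  "polylog [] = 1"
| "polylog (a # w) = Abs_fps (\<lambda>n. if n = 0 then 0 else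
     fps_nth (zero_kernel a * polylog w -
       (if last (a # w) = 0 then polylog (butlast (a # w)) else 0)) n / of_nat n)"
  by pat_completeness auto
termination by (relation "Wellfounded.measure length") auto

declare polylog.simps(2) [simp del]

lemma polylog_nth_0: "fps_nth (polylog w) 0 = (if w = [] then 1 else 0)"
  by (cases w) (auto simp: polylog.simps(2))

definition euler_op :: "complex fps \<Rightarrow> complex fps" where
  "euler_op F = fps_X * fps_deriv F"

lemma euler_op_nth: "fps_nth (euler_op F) n = of_nat n * fps_nth F n"
  by (cases n) (simp_all add: euler_op_def)

lemma euler_op_add: "euler_op (F + G) = euler_op F + euler_op G"
  by (simp add: euler_op_def algebra_simps)

lemma euler_op_mult: "euler_op (F * G) = euler_op F * G + F * euler_op G"
  by (simp add: euler_op_def algebra_simps)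

lemma euler_op_eqI:
  assumes "euler_op F = euler_op G" "fps_nth F 0 = fps_nth G 0"
  shows "F = G"
proof (rule fps_ext)
  fix n
  from assms(1) have "of_nat n * fps_nth F n = of_nat n * fps_nth G n"
    by (metis euler_op_nth)
  with assms(2) show "fps_nth F n = fps_nth G n" by (cases "n = 0") auto
qed

lemma euler_op_polylog:
  "euler_op (polylog (a # w)) = zero_kernel a * polylog w -
     (if last (a # w) = 0 then polylog (butlast (a # w)) else 0)"
    (is "_ = ?rhs")
proof (rule fps_ext)
  fix n
  \<comment> \<open>The delicate case is the word \<open>[0]\<close>: both terms have constant term
    1 and cancel, which is why no logarithm arises.\<close>
  have "fps_nth ?rhs 0 = 0"
    by (cases w) (auto simp: polylog_nth_0 zero_kernel_def)
  then show "fps_nth (euler_op (polylog (a # w))) n = fps_nth ?rhs n"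
    by (cases "n = 0") (simp_all add: euler_op_nth polylog.simps(2))
qed

text \<open>The two terms of the differential equation are separated because one acts at the first
  letter and the other at the last, so that their sums over shuffles are unfolded from different
  ends.\<close>

definition left_part :: "complex list \<Rightarrow> complex fps" where
  "left_part w = (case w of [] \<Rightarrow> 0 | a # w' \<Rightarrow> zero_kernel a * polylog w')"

definition right_part :: "complex list \<Rightarrow> complex fps" where
  "right_part w = (if w \<noteq> [] \<and> last w = 0 then polylog (butlast w) else 0)"

lemma euler_op_polylog': "euler_op (polylog w) = left_part w - right_part w"
proof (cases w)
  case Nil
  then show ?thesis by (simp add: left_part_def right_part_def euler_op_def)
next
  case (Cons a w')
  then show ?thesis by (simp add: left_part_def right_part_def euler_op_polylog)
qed

text \<open>By induction on the total length, \<open>left_part\<close> and \<open>right_part\<close>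
  obey the Leibniz rule on shuffles. Both sides thus have the same image under
  \<open>euler_op\<close>, and for nonempty words both constant terms vanish.\<close>

theorem polylog_shuffle: "shuf_sum polylog u v = polylog u * polylog v"
proof (induction "length u + length v" arbitrary: u v rule: less_induct)
  case less
  show ?case
  proof (cases "u = [] \<or> v = []")
    case False
    then obtain a u' b v' where u: "u = a # u'" and v: "v = b # v'"
      by (meson list.exhaust)
    from False obtain c u2 d v2 where u2: "u = u2 @ [c]" and v2: "v = v2 @ [d]"
      by (meson rev_exhaust)
    have "shuf_sum left_part u v = zero_kernel a * (polylog u' * polylog v) +
        zero_kernel b * (polylog u * polylog v')"
      using less[of u' v] less[of u v']
      by (simp add: u v left_part_def shuf_sum_mult_left)
    then have L: "shuf_sum left_part u v = left_part u * polylog v + polylog u * left_part v"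
      by (simp add: u v left_part_def algebra_simps)
    have r: "(\<lambda>w. right_part (w @ [e])) = (\<lambda>w. (if e = 0 then 1 else 0) * polylog w)" for e
      by (auto simp: right_part_def fun_eq_iff)
    have "shuf_sum right_part u v = (if c = 0 then 1 else 0) * (polylog u2 * polylog v) +
        (if d = 0 then 1 else 0) * (polylog u * polylog v2)"
      using less[of u2 v] less[of u v2]
      by (simp add: u2 v2 shuf_sum_snoc r shuf_sum_mult_left del: mult_if_delta)
    then have R: "shuf_sum right_part u v = right_part u * polylog v + polylog u * right_part v"
      by (simp add: u2 v2 right_part_def)
    show ?thesis
    proof (rule euler_op_eqI)
      have "euler_op (shuf_sum polylog u v) = shuf_sum (\<lambda>w. left_part w - right_part w) u v"
        by (simp add: euler_op_add flip: shuf_sum_hom euler_op_polylog')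
      then show "euler_op (shuf_sum polylog u v) = euler_op (polylog u * polylog v)"
        by (simp add: shuf_sum_diff L R euler_op_mult euler_op_polylog' algebra_simps)
      have "fps_nth (shuf_sum polylog u v) 0 = shuf_sum (\<lambda>w. fps_nth (polylog w) 0) u v"
        by (rule shuf_sum_hom[symmetric]) simp
      also have "\<dots> = shuf_sum (\<lambda>w. 0) u v"
        by (rule shuf_sum_cong) (use False in \<open>auto simp: polylog_nth_0 Nil_in_shuffles\<close>)
      finally show "fps_nth (shuf_sum polylog u v) 0 = fps_nth (polylog u * polylog v) 0"
        using False by (simp add: polylog_nth_0)
    qed
  qed auto
qed

section \<open>Growth of the coefficients\<close>

text \<open>Only the modulus enters the estimates, so all N are covered at once. The set is closed
  under division by its nonzero members, which the rescaling of words requires.\<close>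

definition letters :: "complex set" where
  "letters = {a. a = 0 \<or> norm a = 1}"

text \<open>The exponent 1/2 absorbs the powers of log n that the coefficients carry, so one class
  serves words of every length. Index 0 is left out since \<open>C / sqrt 0\<close> is 0.\<close>

definition sqrt_decay :: "complex fps \<Rightarrow> bool" where
  "sqrt_decay F \<longleftrightarrow> (\<exists>C. \<forall>n\<ge>1. norm (fps_nth F n) \<le> C / sqrt (real n))"

lemma sqrt_decay_nonneg:
  assumes "sqrt_decay F"
  obtains C where "C \<ge> 0" "\<And>n. n \<ge> 1 \<Longrightarrow> norm (fps_nth F n) \<le> C / sqrt (real n)"
proof -
  from assms obtain C where C: "\<And>n. n \<ge> 1 \<Longrightarrow> norm (fps_nth F n) \<le> C / sqrt (real n)"
    by (auto simp: sqrt_decay_def)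
  have "0 \<le> norm (fps_nth F 1)" by simp
  also have "\<dots> \<le> C" using C[of 1] by simp
  finally show thesis using C that by blast
qed

lemma sqrt_decay_1 [simp]: "sqrt_decay 1"
  by (auto simp: sqrt_decay_def intro!: exI[of _ 0])

lemma sqrt_decay_0 [simp]: "sqrt_decay 0"
  by (auto simp: sqrt_decay_def intro!: exI[of _ 0])

lemma sqrt_decay_diff:
  assumes "sqrt_decay F" "sqrt_decay G"
  shows "sqrt_decay (F - G)"
proof -
  from assms obtain C D where
    "\<And>n. n \<ge> 1 \<Longrightarrow> norm (fps_nth F n) \<le> C / sqrt (real n)"
    "\<And>n. n \<ge> 1 \<Longrightarrow> norm (fps_nth G n) \<le> D / sqrt (real n)"
    unfolding sqrt_decay_def by blast
  then have "norm (fps_nth (F - G) n) \<le> (C + D) / sqrt (real n)" if "n \<ge> 1" for n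
    using that norm_triangle_ineq4[of "fps_nth F n" "fps_nth G n"]
    by (fastforce simp: add_divide_distrib intro: order_trans)
  then show ?thesis unfolding sqrt_decay_def by blast
qed

lemma sqrt_decay_cmult:
  assumes "sqrt_decay F"
  shows "sqrt_decay (fps_const c * F)"
proof -
  from assms obtain C where
    "\<And>n. n \<ge> 1 \<Longrightarrow> norm (fps_nth F n) \<le> C / sqrt (real n)"
    unfolding sqrt_decay_def by blast
  then have "norm (fps_nth (fps_const c * F) n) \<le> (norm c * C) / sqrt (real n)" if "n \<ge> 1" for n
    using mult_left_mono[of _ _ "norm c"] that by (fastforce simp: norm_mult)
  then show ?thesis unfolding sqrt_decay_def by blast
qed

lemma sqrt_decay_X_mult:
  assumes "sqrt_decay F"
  shows "sqrt_decay (fps_X * F)"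
proof -
  obtain C where C: "C \<ge> 0" "\<And>n. n \<ge> 1 \<Longrightarrow> norm (fps_nth F n) \<le> C / sqrt (real n)"
    using sqrt_decay_nonneg[OF assms] by blast
  \<comment> \<open>Coefficient 1 of the shifted series is the constant term of \<open>F\<close>,
    which \<open>C\<close> does not control. The factor 2 pays for
    \<open>sqrt n \<le> 2 * sqrt (n - 1)\<close> when n \<ge> 2.\<close>
  define K where "K = norm (fps_nth F 0) + 2 * C"
  have "norm (fps_nth (fps_X * F) n) \<le> K / sqrt (real n)" if "n \<ge> 1" for n
  proof (cases "n = 1")
    case True
    then show ?thesis using C(1) by (simp add: K_def)
  next
    case False
    with that have n: "n \<ge> 2" by simp
    have "sqrt (real n) \<le> sqrt (4 * real (n - 1))"
      using n by (intro real_sqrt_le_mono) simp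
    then have sq: "sqrt (real n) \<le> 2 * sqrt (real (n - 1))"
      by (simp add: real_sqrt_mult)
    have "C * sqrt (real n) \<le> C * (2 * sqrt (real (n - 1)))"
      by (rule mult_left_mono[OF sq C(1)])
    then have "C / sqrt (real (n - 1)) \<le> 2 * C / sqrt (real n)"
      using n by (simp add: field_simps)
    also have "\<dots> \<le> K / sqrt (real n)" by (simp add: K_def divide_right_mono)
    finally have "C / sqrt (real (n - 1)) \<le> K / sqrt (real n)" .
    moreover have "norm (fps_nth F (n - 1)) \<le> C / sqrt (real (n - 1))"
      by (rule C(2)) (use n in linarith)
    ultimately show ?thesis using n by simp
  qed
  then show ?thesis unfolding sqrt_decay_def by blast
qed

lemma sqrt_decay_eulerD:
  assumes "sqrt_decay (euler_op F)"
  shows "sqrt_decay F"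
proof -
  obtain C where C: "C \<ge> 0" "\<And>n. n \<ge> 1 \<Longrightarrow> norm (fps_nth (euler_op F) n) \<le> C / sqrt (real n)"
    using sqrt_decay_nonneg[OF assms] by blast
  have "norm (fps_nth F n) \<le> C / sqrt (real n)" if "n \<ge> 1" for n
  proof -
    have "norm (fps_nth F n) * 1 \<le> norm (fps_nth F n) * real n"
      by (rule mult_left_mono) (use that in auto)
    also have "\<dots> = norm (fps_nth (euler_op F) n)"
      by (simp add: euler_op_nth norm_mult)
    finally show ?thesis using C(2)[OF that] by simp
  qed
  then show ?thesis unfolding sqrt_decay_def by blast
qed

lemma sum_inverse_sqrt_le: "(\<Sum>k=1..n. 1 / sqrt (real k)) \<le> 2 * sqrt (real n)"
proof (induction n)
  case (Suc n)
  let ?a = "sqrt (real n)" and ?b = "sqrt (real (Suc n))"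
  \<comment> \<open>Adding the square of \<open>?b - ?a\<close> to this product gives
    \<open>2 * (?b - ?a) * ?b\<close>, so the latter is at least 1.\<close>
  have "(?b - ?a) * (?b + ?a) = 1" by (simp add: algebra_simps)
  moreover have "(?b - ?a) * (?b - ?a) \<ge> 0" by simp
  ultimately have "1 \<le> 2 * (?b - ?a) * ?b" unfolding ring_distribs by argo
  then have "1 / ?b \<le> 2 * (?b - ?a)" by (subst pos_divide_le_eq) auto
  with Suc show ?case by simp
qed simp

text \<open>The kernel has coefficients of modulus at most 1, so the convolution is bounded by a
  partial sum of \<open>1 / sqrt k\<close>.\<close>

lemma zero_kernel_mult_bound:
  assumes "a \<noteq> 0" "norm a = 1" "sqrt_decay F"
  obtains K where "\<And>n. n \<ge> 1 \<Longrightarrow> norm (fps_nth (zero_kernel a * F) n) \<le> K * sqrt (real n)"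
proof -
  obtain C where C: "C \<ge> 0" "\<And>n. n \<ge> 1 \<Longrightarrow> norm (fps_nth F n) \<le> C / sqrt (real n)"
    using sqrt_decay_nonneg[OF assms(3)] by blast
  have "norm (fps_nth (zero_kernel a * F) n) \<le> (norm (fps_nth F 0) + 2 * C) * sqrt (real n)"
    if n: "n \<ge> 1" for n
  proof -
    have "norm (fps_nth (zero_kernel a * F) n) \<le>
        (\<Sum>i=0..n. norm (fps_nth (zero_kernel a) i * fps_nth F (n - i)))"
      unfolding fps_mult_nth by (rule norm_sum)
    also have "\<dots> \<le> (\<Sum>i=0..n. norm (fps_nth F (n - i)))"
      by (rule sum_mono)
        (auto simp: zero_kernel_def assms norm_mult norm_power)
    also have "\<dots> = (\<Sum>i=0..n. norm (fps_nth F i))"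
      using sum.atLeastAtMost_rev[of "\<lambda>i. norm (fps_nth F i)" 0 n] by simp
    also have "\<dots> = norm (fps_nth F 0) + (\<Sum>i=1..n. norm (fps_nth F i))"
      by (simp add: sum.atLeast_Suc_atMost)
    also have "(\<Sum>i=1..n. norm (fps_nth F i)) \<le> (\<Sum>i=1..n. C * (1 / sqrt (real i)))"
      by (rule sum_mono) (use C(2) in auto)
    also have "\<dots> = C * (\<Sum>i=1..n. 1 / sqrt (real i))"
      by (rule sum_distrib_left[symmetric])
    also have "\<dots> \<le> C * (2 * sqrt (real n))"
      by (rule mult_left_mono[OF sum_inverse_sqrt_le C(1)])
    also have "norm (fps_nth F 0) \<le> norm (fps_nth F 0) * sqrt (real n)"
      using n mult_left_mono[of 1 "sqrt (real n)" "norm (fps_nth F 0)"] by simp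
    finally show ?thesis by (simp add: algebra_simps)
  qed
  then show thesis using that by blast
qed

text \<open>Convolution with the kernel of a letter of modulus 1 raises the exponent of n by 1, and
  inverting \<open>euler_op\<close> lowers it by 1. The remaining terms only gain from the
  inversion.\<close>

lemma polylog_sqrt_decay:
  assumes "set w \<subseteq> letters"
  shows "sqrt_decay (polylog w)"
  using assms
proof (induction "length w" arbitrary: w rule: less_induct)
  case less
  show ?case
  proof (cases w)
    case (Cons a w')
    define R where "R = (if last w = 0 then polylog (butlast w) else 0)"
    have "set (butlast w) \<subseteq> letters" using less.prems by (meson in_set_butlastD subset_eq)
    then have R: "sqrt_decay R"
      using less.hyps[of "butlast w"] by (simp add: R_def Cons)
    have w': "sqrt_decay (polylog w')" using less by (simp add: Cons)
    have e: "euler_op (polylog w) = zero_kernel a * polylog w' - R"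
      by (simp add: Cons euler_op_polylog R_def)
    show ?thesis
    proof (cases "a = 0")
      case True
      then have "euler_op (polylog w) = polylog w' - R"
        by (simp add: e zero_kernel_def)
      then show ?thesis by (metis sqrt_decay_diff sqrt_decay_eulerD R w')
    next
      case False
      then have "norm a = 1" using less.prems by (auto simp: Cons letters_def)
      with False obtain K where
        K: "\<And>n. n \<ge> 1 \<Longrightarrow> norm (fps_nth (zero_kernel a * polylog w') n) \<le> K * sqrt (real n)"
        using zero_kernel_mult_bound w' by blast
      obtain D where D: "D \<ge> 0" "\<And>n. n \<ge> 1 \<Longrightarrow> norm (fps_nth R n) \<le> D / sqrt (real n)"
        using sqrt_decay_nonneg[OF R] by blast
      have "norm (fps_nth (polylog w) n) \<le> (K + D) / sqrt (real n)" if n: "n \<ge> 1" for n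
      proof -
        have "real n * norm (fps_nth (polylog w) n) = norm (fps_nth (zero_kernel a * polylog w' - R) n)"
          by (simp add: euler_op_nth norm_mult flip: e)
        also have "\<dots> \<le> K * sqrt (real n) + D / sqrt (real n)"
          using K[OF n] D(2)[OF n] norm_triangle_ineq4[of "fps_nth (zero_kernel a * polylog w') n" "fps_nth R n"]
          by simp
        also have "D / sqrt (real n) \<le> D * sqrt (real n)"
        proof -
          have "1 \<le> sqrt (real n) * sqrt (real n)" using n by simp
          then have "D * 1 \<le> D * (sqrt (real n) * sqrt (real n))" using D(1) by (rule mult_left_mono)
          then show ?thesis using n by (simp add: field_simps)
        qed
        finally have "norm (fps_nth (polylog w) n) * (sqrt (real n) * sqrt (real n)) \<le>
            (K + D) * sqrt (real n)"
          by (simp add: algebra_simps)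
        then have "norm (fps_nth (polylog w) n) * sqrt (real n) \<le> K + D"
          by (rule_tac mult_right_le_imp_le[of _ "sqrt (real n)"]) (use n in \<open>simp_all add: mult.assoc\<close>)
        then show ?thesis using n by (simp add: field_simps)
      qed
      then show ?thesis unfolding sqrt_decay_def by blast
    qed
  qed simp
qed

text \<open>Multiplying by \<open>1 - a X\<close> removes the pole at \<open>1/a\<close> and gains a factor \<open>1/n\<close> in the decay of
  the coefficients.\<close>

lemma polylog_times_linear_decay:
  assumes "set (a # w) \<subseteq> letters"
  shows "sqrt_decay (euler_op ((1 - fps_const a * fps_X) * polylog (a # w)))"
proof -
  let ?F = "polylog (a # w)" and ?P = "1 - fps_const a * fps_X :: complex fps"
  define R where "R = (if last (a # w) = 0 then polylog (butlast (a # w)) else 0)"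
  have "set (butlast (a # w)) \<subseteq> letters" using assms by (meson in_set_butlastD subset_eq)
  then have R: "sqrt_decay R" by (simp add: R_def polylog_sqrt_decay)
  have w: "sqrt_decay (polylog w)" and F: "sqrt_decay ?F"
    using assms by (auto intro!: polylog_sqrt_decay)
  show ?thesis
  proof (cases "a = 0")
    case True
    then have "euler_op (?P * ?F) = polylog w - R"
      by (simp only: R_def) (simp add: euler_op_polylog zero_kernel_def)
    then show ?thesis using sqrt_decay_diff[OF w R] by simp
  next
    case False
    \<comment> \<open>The kernel is \<open>a X / (1 - a X)\<close>; the factor cancels its
      denominator.\<close>
    have k: "?P * zero_kernel a = fps_const a * fps_X"
    proof (rule fps_ext)
      fix n
      show "fps_nth (?P * zero_kernel a) n = fps_nth (fps_const a * fps_X) n"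
        using False
        by (cases n) (auto simp: zero_kernel_def algebra_simps fps_mult_left_const_nth mult.assoc)
    qed
    have eP: "euler_op ?P = - (fps_const a * fps_X)"
      by (simp add: euler_op_def)
    have "euler_op (?P * ?F) = ?P * (zero_kernel a * polylog w - R) - fps_const a * (fps_X * ?F)"
      by (simp only: euler_op_mult eP) (simp add: euler_op_polylog R_def mult.assoc)
    also have "?P * (zero_kernel a * polylog w - R) =
        fps_const a * (fps_X * polylog w) - (R - fps_const a * (fps_X * R))"
      by (simp only: right_diff_distrib mult.assoc[symmetric] k) (simp add: algebra_simps)
    finally show ?thesis
      by (simp only:) (intro sqrt_decay_diff sqrt_decay_cmult sqrt_decay_X_mult R w F)
  qed
qed

section \<open>Behaviour of the power series as z tends to 1\<close>

lemma sqrt_decay_bounded: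
  assumes "sqrt_decay F"
  obtains K where "\<And>n. norm (fps_nth F n) \<le> K"
proof -
  obtain C where C: "C \<ge> 0" "\<And>n. n \<ge> 1 \<Longrightarrow> norm (fps_nth F n) \<le> C / sqrt (real n)"
    using sqrt_decay_nonneg[OF assms] by blast
  have "norm (fps_nth F n) \<le> norm (fps_nth F 0) + C" for n
  proof (cases "n = 0")
    case False
    then have "C / sqrt (real n) \<le> C / 1"
      using C(1) by (intro divide_left_mono) auto
    then have "norm (fps_nth F n) \<le> C" using C(2)[of n] False by simp
    then show ?thesis
      using norm_ge_zero[of "fps_nth F 0"] by linarith
  qed (use C(1) in auto)
  then show thesis using that by blast
qed

lemma conv_radius_ge_1:
  assumes "sqrt_decay F"
  shows "fps_conv_radius F \<ge> 1"
proof -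
  obtain K where K: "\<And>n. norm (fps_nth F n) \<le> K"
    using sqrt_decay_bounded[OF assms] by blast
  show ?thesis unfolding fps_conv_radius_def
  proof (rule conv_radius_geI_ex)
    fix r :: real assume r: "0 < r" "ereal r < 1"
    then have "summable (\<lambda>n. K * r ^ n)"
      by (intro summable_mult summable_geometric) auto
    then have "summable (\<lambda>n. fps_nth F n * of_real r ^ n)"
      by (rule summable_comparison_test'[where N = 0])
        (use r K in \<open>auto simp: norm_mult norm_power intro!: mult_right_mono\<close>)
    then show "\<exists>z. norm z = r \<and> summable (\<lambda>n. fps_nth F n * z ^ n)"
      using r by (intro exI[of _ "of_real r"]) auto
  qed
qed

text \<open>Interpolates between the bound 1 and Bernoulli's bound \<open>n (1 - z)\<close>. The
  exponent 1/4 is small enough to keep n^(-3/2) n^(1/4) summable and still leaves a positive power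
  of 1 - z.\<close>

lemma one_minus_power_le:
  assumes "0 \<le> z" "z \<le> (1::real)"
  shows "1 - z ^ n \<le> (real n * (1 - z)) powr (1/4)"
proof -
  have a: "1 - z ^ n \<le> real n * (1 - z)"
    using Bernoulli_inequality[of "z - 1" n] assms by (simp add: algebra_simps)
  have nn: "0 \<le> real n * (1 - z)" using assms by simp
  show ?thesis
  proof (cases "real n * (1 - z) \<le> 1")
    case True
    have "(real n * (1 - z)) powr 1 \<le> (real n * (1 - z)) powr (1/4)"
      using nn True by (intro powr_mono') auto
    then show ?thesis using a nn by simp
  next
    case False
    then have "1 \<le> (real n * (1 - z)) powr (1/4)" by (intro ge_one_powr_ge_zero) auto
    moreover have "1 - z ^ n \<le> 1" using assms by simp
    ultimately show ?thesis by linarith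
  qed
qed

text \<open>A quantitative Abel limit: the coefficients are O(n^(-3/2)), and the weight 1 - z^n
  costs only n^(1/4), so that a convergent sum of n^(-5/4) remains.\<close>

lemma eval_fps_rate:
  assumes "sqrt_decay (euler_op F)"
  obtains K where "summable (\<lambda>n. norm (fps_nth F n))"
    "\<And>z. 0 \<le> z \<Longrightarrow> z < 1 \<Longrightarrow>
       norm (eval_fps F (of_real z) - (suminf (\<lambda>n. fps_nth F n))) \<le> K * (1 - z) powr (1/4)"
proof -
  obtain C where C: "C \<ge> 0"
    "\<And>n. n \<ge> 1 \<Longrightarrow> norm (fps_nth (euler_op F) n) \<le> C / sqrt (real n)"
    using sqrt_decay_nonneg[OF assms] by blast
  have b: "norm (fps_nth F n) \<le> C * real n powr (-3/2)" if "n \<ge> 1" for n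
  proof -
    have "real n * norm (fps_nth F n) \<le> C / sqrt (real n)"
      using C(2)[OF that] by (simp add: euler_op_nth norm_mult)
    then have "norm (fps_nth F n) \<le> C * (inverse (sqrt (real n)) * inverse (real n))"
      using that by (simp add: field_simps)
    also have "inverse (sqrt (real n)) = real n powr - (1/2)"
      using that by (simp only: powr_minus powr_half_sqrt of_nat_0_le_iff)
    also have "inverse (real n) = real n powr - 1"
      using that by (simp only: powr_minus powr_one of_nat_0_le_iff)
    also have "real n powr - (1/2) * real n powr - 1 = real n powr (-3/2)"
      by (simp only: powr_add[symmetric]) simp
    finally show ?thesis .
  qed
  have s54: "summable (\<lambda>n. C * real n powr (-5/4))"
    by (intro summable_mult) (subst summable_real_powr_iff, simp)
  have s32: "summable (\<lambda>n. C * real n powr (-3/2))"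
    by (intro summable_mult) (subst summable_real_powr_iff, simp)
  have sF: "summable (\<lambda>n. norm (fps_nth F n))"
    by (rule summable_comparison_test'[OF s32, where N = 1]) (use b in auto)
  have "norm (eval_fps F (of_real z) - (suminf (\<lambda>n. fps_nth F n))) \<le>
      (suminf (\<lambda>n. C * real n powr (-5/4))) * (1 - z) powr (1/4)" if z: "0 \<le> z" "z < 1" for z
  proof -
    have t: "norm (fps_nth F n * (1 - of_real z ^ n)) \<le> (C * real n powr (-5/4)) * (1 - z) powr (1/4)"
      for n
    proof (cases "n = 0")
      case False
      have "norm (1 - of_real z ^ n :: complex) = \<bar>1 - z ^ n\<bar>"
        by (metis norm_of_real of_real_1 of_real_diff of_real_power)
      then have "norm (1 - of_real z ^ n :: complex) = 1 - z ^ n"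
        using z by (simp add: power_le_one)
      also have "\<dots> \<le> (real n * (1 - z)) powr (1/4)" using z by (intro one_minus_power_le) auto
      finally have "norm (fps_nth F n * (1 - of_real z ^ n)) \<le>
          (C * real n powr (-3/2)) * (real n * (1 - z)) powr (1/4)"
        unfolding norm_mult using b[of n] False by (intro mult_mono) (auto simp: C(1))
      also have "\<dots> = C * (real n powr (-3/2) * real n powr (1/4)) * (1 - z) powr (1/4)"
        using z by (simp add: powr_mult)
      also have "real n powr (-3/2) * real n powr (1/4) = real n powr (-5/4)"
        by (simp flip: powr_add)
      finally show ?thesis .
    qed auto
    have sz: "summable (\<lambda>n. fps_nth F n * of_real z ^ n)"
    proof (rule summable_norm_cancel, rule summable_comparison_test'[OF sF, where N = 0])
      fix n
      show "norm (norm (fps_nth F n * of_real z ^ n)) \<le> norm (fps_nth F n)"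
        using z by (simp add: norm_mult norm_power mult_left_le power_le_one)
    qed
    have "eval_fps F (of_real z) - (suminf (\<lambda>n. fps_nth F n)) =
        (suminf (\<lambda>n. fps_nth F n * of_real z ^ n - fps_nth F n))"
      unfolding eval_fps_def by (rule suminf_diff[OF sz summable_norm_cancel[OF sF]])
    also have "\<dots> = - (suminf (\<lambda>n. fps_nth F n * (1 - of_real z ^ n)))"
      by (subst suminf_minus[symmetric])
        (use summable_diff[OF summable_norm_cancel[OF sF] sz] in \<open>auto simp: algebra_simps\<close>)
    finally have "norm (eval_fps F (of_real z) - (suminf (\<lambda>n. fps_nth F n))) =
        norm (suminf (\<lambda>n. fps_nth F n * (1 - of_real z ^ n)))" by simp
    also have "\<dots> \<le> (suminf (\<lambda>n. (C * real n powr (-5/4)) * (1 - z) powr (1/4)))"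
      by (rule norm_suminf_le[OF t summable_mult2[OF s54]])
    also have "\<dots> = (suminf (\<lambda>n. C * real n powr (-5/4))) * (1 - z) powr (1/4)"
      by (rule suminf_mult2[symmetric, OF s54])
    finally show ?thesis .
  qed
  then show thesis using that sF by blast
qed

text \<open>The error class of the regularization. Decay against all powers of t lets errors absorb
  polynomial factors, as products of regularizations require, and still excludes every nonzero
  polynomial.\<close>

definition rapid_decay :: "(real \<Rightarrow> complex) \<Rightarrow> bool" where
  "rapid_decay f \<longleftrightarrow> (\<forall>k. ((\<lambda>t. f t * of_real t ^ k) \<longlongrightarrow> 0) at_top)"

lemma rapid_decay_0 [simp]: "rapid_decay (\<lambda>_. 0)"
  by (simp add: rapid_decay_def)

lemma rapid_decay_add: "rapid_decay f \<Longrightarrow> rapid_decay g \<Longrightarrow> rapid_decay (\<lambda>t. f t + g t)"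
  unfolding rapid_decay_def by (auto simp: distrib_right intro: tendsto_add_zero)

lemma rapid_decay_uminus: "rapid_decay f \<Longrightarrow> rapid_decay (\<lambda>t. - f t)"
  unfolding rapid_decay_def by (auto intro: tendsto_minus_cancel)

lemma rapid_decay_mult_tendsto:
  assumes "rapid_decay f" "(g \<longlongrightarrow> L) at_top"
  shows "rapid_decay (\<lambda>t. f t * g t)"
  unfolding rapid_decay_def
proof
  fix k
  have "((\<lambda>t. (f t * of_real t ^ k) * g t) \<longlongrightarrow> 0 * L) at_top"
    using assms by (intro tendsto_mult) (auto simp: rapid_decay_def)
  then show "((\<lambda>t. f t * g t * of_real t ^ k) \<longlongrightarrow> 0) at_top" by (simp add: mult_ac)
qed

lemma rapid_decay_mult:
  assumes "rapid_decay f" "rapid_decay g"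
  shows "rapid_decay (\<lambda>t. f t * g t)"
proof (rule rapid_decay_mult_tendsto[OF assms(1)])
  show "(g \<longlongrightarrow> 0) at_top" using assms(2)[unfolded rapid_decay_def, rule_format, of 0] by simp
qed

lemma rapid_decay_cmult: "rapid_decay f \<Longrightarrow> rapid_decay (\<lambda>t. c * f t)"
  using rapid_decay_mult_tendsto[OF _ tendsto_const, of f c] by (simp add: mult.commute)

lemma rapid_decay_mult_ident: "rapid_decay f \<Longrightarrow> rapid_decay (\<lambda>t. of_real t * f t)"
  unfolding rapid_decay_def
proof
  fix k assume "\<forall>k. ((\<lambda>t. f t * of_real t ^ k) \<longlongrightarrow> 0) at_top"
  from this[rule_format, of "Suc k"]
  show "((\<lambda>t. of_real t * f t * of_real t ^ k) \<longlongrightarrow> 0) at_top" by (simp add: mult_ac)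
qed

lemma rapid_decay_mult_poly:
  assumes "rapid_decay f"
  shows "rapid_decay (\<lambda>t. poly P (of_real t) * f t)"
proof (induction P)
  case (pCons a P)
  have "rapid_decay (\<lambda>t. a * f t + of_real t * (poly P (of_real t) * f t))"
    by (intro rapid_decay_add rapid_decay_cmult rapid_decay_mult_ident pCons assms)
  then show ?case by (simp add: algebra_simps)
qed simp

lemma rapid_decay_poly_imp_0:
  assumes "rapid_decay (\<lambda>t. poly P (of_real t))"
  shows "P = 0"
proof -
  have lim: "((\<lambda>t. poly P (of_real t)) \<longlongrightarrow> 0) at_top"
    using assms[unfolded rapid_decay_def, rule_format, of 0] by simp
  have "degree P = 0"
  proof (rule ccontr)
    assume "degree P \<noteq> 0"
    then have "filterlim (poly P) at_infinity at_infinity"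
      by (intro filterlim_poly_at_infinity) simp
    moreover have "filterlim (of_real :: real \<Rightarrow> complex) at_infinity at_top"
      by (rule filterlim_of_real_at_infinity)
    ultimately have "filterlim (\<lambda>t. poly P (of_real t)) at_infinity at_top"
      by (rule filterlim_compose)
    with lim show False
      using not_tendsto_and_filterlim_at_infinity by (metis trivial_limit_at_top_linorder)
  qed
  then obtain c where "P = [:c:]" by (metis degree_eq_zeroE)
  with lim show ?thesis by (simp add: tendsto_const_iff)
qed

text \<open>The rate 1/4 is the exponent of \<open>eval_fps_rate\<close>, since 1 - z = exp (-
  t).\<close>

lemma rapid_decay_exp_bound:
  assumes "\<And>t. t > 0 \<Longrightarrow> norm (f t) \<le> K * exp (- (t / 4))"
  shows "rapid_decay f"
  unfolding rapid_decay_def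
proof
  fix k :: nat
  have "filterlim (\<lambda>t::real. t / 4) at_top at_top"
    using filterlim_tendsto_pos_mult_at_top[OF tendsto_const _ filterlim_ident, of "1/4 :: real"]
    by simp
  from filterlim_compose[OF tendsto_power_div_exp_0[of k] this]
  have "((\<lambda>t. K * 4 ^ k * ((t / 4) ^ k / exp (t / 4))) \<longlongrightarrow> K * 4 ^ k * 0) at_top"
    by (intro tendsto_mult tendsto_const)
  moreover have "K * 4 ^ k * ((t / 4) ^ k / exp (t / 4)) = K * exp (- (t / 4)) * t ^ k" for t :: real
  proof -
    have "exp (- (t / 4)) = 1 / exp (t / 4)" by (simp add: exp_minus inverse_eq_divide)
    then show ?thesis by (simp only: power_divide) simp
  qed
  ultimately have lim: "((\<lambda>t. K * exp (- (t / 4)) * t ^ k) \<longlongrightarrow> 0) at_top"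
    by (simp only: mult_zero_right)
  show "((\<lambda>t. f t * of_real t ^ k) \<longlongrightarrow> 0) at_top"
  proof (rule tendsto_norm_zero_cancel, rule tendsto_sandwich[OF _ _ tendsto_const lim])
    show "\<forall>\<^sub>F t in at_top. norm (f t * of_real t ^ k) \<le> K * exp (- (t / 4)) * t ^ k"
      using eventually_gt_at_top[of 0]
      by eventually_elim (auto simp: norm_mult norm_power intro!: mult_right_mono assms)
  qed auto
qed

section \<open>Regularized values at 1\<close>

text \<open>\<open>F(z)\<close> is compared with a polynomial in \<open>t = - log (1 - z)\<close> as \<open>z\<close> tends to \<open>1\<close>.\<close>

definition regularizes :: "complex fps \<Rightarrow> complex poly \<Rightarrow> bool" where
  "regularizes F P \<longleftrightarrow> fps_conv_radius F \<ge> 1 \<and>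
     rapid_decay (\<lambda>t. eval_fps F (of_real (1 - exp (- t))) - poly P (of_real t))"

lemma rapid_decay_cong:
  assumes "\<And>t. t > 0 \<Longrightarrow> f t = g t" "rapid_decay f"
  shows "rapid_decay g"
  unfolding rapid_decay_def
proof
  fix k
  show "((\<lambda>t. g t * of_real t ^ k) \<longlongrightarrow> 0) at_top"
  proof (rule Lim_transform_eventually[OF assms(2)[unfolded rapid_decay_def, rule_format]])
    show "\<forall>\<^sub>F t in at_top. f t * of_real t ^ k = g t * of_real t ^ k"
      using eventually_gt_at_top[of 0] by eventually_elim (simp add: assms(1))
  qed
qed

lemma in_conv_disc:
  assumes "fps_conv_radius F \<ge> 1" "t > 0"
  shows "ereal (norm (of_real (1 - exp (- t)) :: complex)) < fps_conv_radius F"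
proof -
  have "norm (of_real (1 - exp (- t)) :: complex) = 1 - exp (- t)"
    using assms(2) by (simp only: norm_of_real) simp
  then have "ereal (norm (of_real (1 - exp (- t)) :: complex)) < 1" by simp
  with assms(1) show ?thesis by (rule less_le_trans[rotated])
qed

lemma regularizes_const [simp]: "regularizes (fps_const c) [:c:]"
  by (simp add: regularizes_def)

lemma regularizes_1 [simp]: "regularizes 1 1"
  by (simp add: regularizes_def)

lemma regularizes_0 [simp]: "regularizes 0 0"
  by (simp add: regularizes_def)

lemma regularizes_add:
  assumes "regularizes F P" "regularizes G Q"
  shows "regularizes (F + G) (P + Q)"
  unfolding regularizes_def
proof
  show "fps_conv_radius (F + G) \<ge> 1"
    using fps_conv_radius_add[of F G] assms by (auto simp: regularizes_def intro: order_trans[rotated])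
  have "rapid_decay (\<lambda>t. (eval_fps F (of_real (1 - exp (- t))) - poly P (of_real t)) +
      (eval_fps G (of_real (1 - exp (- t))) - poly Q (of_real t)))"
    using assms by (intro rapid_decay_add) (auto simp: regularizes_def)
  then show "rapid_decay (\<lambda>t. eval_fps (F + G) (of_real (1 - exp (- t))) - poly (P + Q) (of_real t))"
  proof (rule rapid_decay_cong[rotated])
    fix t :: real assume "t > 0"
    then have "eval_fps (F + G) (of_real (1 - exp (- t))) =
        eval_fps F (of_real (1 - exp (- t))) + eval_fps G (of_real (1 - exp (- t)))"
      using assms by (intro eval_fps_add in_conv_disc) (auto simp: regularizes_def)
    then show "(eval_fps F (of_real (1 - exp (- t))) - poly P (of_real t)) +
        (eval_fps G (of_real (1 - exp (- t))) - poly Q (of_real t)) =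
        eval_fps (F + G) (of_real (1 - exp (- t))) - poly (P + Q) (of_real t)"
      by simp
  qed
qed

lemma regularizes_mult:
  assumes "regularizes F P" "regularizes G Q"
  shows "regularizes (F * G) (P * Q)"
  unfolding regularizes_def
proof
  show "fps_conv_radius (F * G) \<ge> 1"
    using fps_conv_radius_mult[of F G] assms by (auto simp: regularizes_def intro: order_trans[rotated])
  define f where "f = (\<lambda>t. eval_fps F (of_real (1 - exp (- t))) - poly P (of_real t))"
  define g where "g = (\<lambda>t. eval_fps G (of_real (1 - exp (- t))) - poly Q (of_real t))"
  have fg: "rapid_decay f" "rapid_decay g" using assms by (auto simp: regularizes_def f_def g_def)
  have "rapid_decay (\<lambda>t. f t * g t + (poly P (of_real t) * g t + poly Q (of_real t) * f t))"
    by (intro rapid_decay_add rapid_decay_mult rapid_decay_mult_poly fg)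
  then show "rapid_decay (\<lambda>t. eval_fps (F * G) (of_real (1 - exp (- t))) - poly (P * Q) (of_real t))"
  proof (rule rapid_decay_cong[rotated])
    fix t :: real assume "t > 0"
    then have "eval_fps (F * G) (of_real (1 - exp (- t))) =
        eval_fps F (of_real (1 - exp (- t))) * eval_fps G (of_real (1 - exp (- t)))"
      using assms by (intro eval_fps_mult in_conv_disc) (auto simp: regularizes_def)
    then show "f t * g t + (poly P (of_real t) * g t + poly Q (of_real t) * f t) =
        eval_fps (F * G) (of_real (1 - exp (- t))) - poly (P * Q) (of_real t)"
      by (simp add: f_def g_def algebra_simps)
  qed
qed

lemma regularizes_unique:
  assumes "regularizes F P" "regularizes F Q"
  shows "P = Q"
proof -
  have "rapid_decay (\<lambda>t. (eval_fps F (of_real (1 - exp (- t))) - poly Q (of_real t)) +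
      - (eval_fps F (of_real (1 - exp (- t))) - poly P (of_real t)))"
    using assms by (intro rapid_decay_add rapid_decay_uminus) (auto simp: regularizes_def)
  then have "rapid_decay (\<lambda>t. poly (P - Q) (of_real t))" by simp
  then show ?thesis using rapid_decay_poly_imp_0 by fastforce
qed

lemma fps_nth_polylog_singleton: "fps_nth (polylog [1]) n = 1 / of_nat n"
  by (simp add: polylog.simps(2) zero_kernel_def)

lemma regularizes_polylog_1: "regularizes (polylog [1]) [:0, 1:]"
  unfolding regularizes_def
proof
  show "fps_conv_radius (polylog [1]) \<ge> 1"
    by (intro conv_radius_ge_1 polylog_sqrt_decay) (simp add: letters_def)
  show "rapid_decay (\<lambda>t. eval_fps (polylog [1]) (of_real (1 - exp (- t))) - poly [:0, 1:] (of_real t))"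
  \<comment> \<open>This series is exactly - log (1 - z), so the error is 0 for every t > 0.\<close>
  proof (rule rapid_decay_cong[OF _ rapid_decay_0])
    fix t :: real assume "t > 0"
    define z :: complex where "z = of_real (1 - exp (- t))"
    have "norm z = 1 - exp (- t)" using \<open>t > 0\<close> unfolding z_def by (simp only: norm_of_real) simp
    then have "norm z < 1" by simp
    then have "(\<lambda>n. - (- (z ^ n) / of_nat n)) sums (- ln (1 + - z))"
      using sums_minus[OF Ln_series'[of "- z"]] by simp
    then have "(\<lambda>n. fps_nth (polylog [1]) n * z ^ n) sums (- ln (1 - z))"
      by (simp add: fps_nth_polylog_singleton)
    moreover have "ln (1 - z) = of_real (- t)"
    proof -
      have "1 - z = exp (of_real (- t))" unfolding z_def exp_of_real by simp
      then show ?thesis by (simp del: of_real_minus)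
    qed
    ultimately show "0 = eval_fps (polylog [1]) (of_real (1 - exp (- t))) - poly [:0, 1:] (of_real t)"
      unfolding z_def[symmetric] eval_fps_def by (simp add: sums_iff)
  qed
qed

text \<open>Multiplication by 1 - a X makes the coefficients summable, and since a \<noteq> 1 the
  factor 1 - a z can be divided out near z = 1. The same \<open>L\<close> is the sum of the
  coefficients and the regularization, which ties convergent words to their ordinary values.\<close>

lemma polylog_not1_regularizes:
  assumes "set w \<subseteq> letters" "w \<noteq> [] \<longrightarrow> hd w \<noteq> 1"
  obtains L where "fps_nth (polylog w) sums L" "regularizes (polylog w) [:L:]"
proof (cases w)
  case Nil
  have "(\<lambda>n. fps_nth (polylog []) n) sums 1"
    using sums_If_finite_set[of "{0}" "\<lambda>_. 1::complex"] by (simp add: if_distrib cong: if_cong)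
  moreover have "regularizes (polylog w) [:1:]" by (simp add: Nil flip: one_pCons)
  ultimately show thesis using that Nil by blast
next
  case (Cons a v)
  have a: "a \<noteq> 1" "a \<in> letters" using assms by (auto simp: Cons)
  let ?F = "polylog w"
  define D where "D = (1 - fps_const a * fps_X) * ?F"
  have F: "sqrt_decay ?F" using assms by (intro polylog_sqrt_decay)
  have D: "sqrt_decay (euler_op D)"
    unfolding D_def Cons using assms by (intro polylog_times_linear_decay) (simp add: Cons)
  obtain K where K: "summable (\<lambda>n. norm (fps_nth D n))"
    "\<And>z. 0 \<le> z \<Longrightarrow> z < 1 \<Longrightarrow>
       norm (eval_fps D (of_real z) - suminf (\<lambda>n. fps_nth D n)) \<le> K * (1 - z) powr (1/4)"
    using eval_fps_rate[OF D] by blast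
  define S where "S = suminf (\<lambda>n. fps_nth D n)"
  define L where "L = S / (1 - a)"
  have DS: "fps_nth D sums S"
    using summable_sums[OF summable_norm_cancel[OF K(1)]] by (simp add: S_def)
  have "fps_nth ?F sums L"
  proof -
    \<comment> \<open>Partial sums of \<open>D\<close> determine those of \<open>?F\<close> up to a
      multiple of the last coefficient, which tends to 0.\<close>
    have part: "(\<Sum>i\<le>n. fps_nth D i) = (1 - a) * (\<Sum>i\<le>n. fps_nth ?F i) + a * fps_nth ?F n" for n
    proof (induction n)
      case 0
      then show ?case by (simp add: D_def algebra_simps)
    next
      case (Suc n)
      have "fps_nth D (Suc n) = fps_nth ?F (Suc n) - a * fps_nth ?F n"
        by (simp add: D_def algebra_simps mult.assoc fps_mult_left_const_nth)
      with Suc show ?case by (simp add: algebra_simps)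
    qed
    obtain C where C: "\<And>n. n \<ge> 1 \<Longrightarrow> norm (fps_nth ?F n) \<le> C / sqrt (real n)"
      using F by (auto simp: sqrt_decay_def)
    have "(\<lambda>n. C / sqrt (real n)) \<longlonglongrightarrow> 0"
      by (intro tendsto_divide_0[OF tendsto_const] filterlim_at_top_imp_at_infinity
          filterlim_compose[OF sqrt_at_top filterlim_real_sequentially])
    then have F0: "fps_nth ?F \<longlonglongrightarrow> 0"
      by (rule Lim_null_comparison[rotated]) (use C in \<open>auto simp: eventually_at_top_linorder\<close>)
    have "(\<lambda>n. ((\<Sum>i\<le>n. fps_nth D i) - a * fps_nth ?F n) / (1 - a)) \<longlonglongrightarrow> (S - a * 0) / (1 - a)"
      using DS[unfolded sums_def_le] a F0 by (intro tendsto_intros) auto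
    then show ?thesis using a by (simp add: sums_def_le part L_def)
  qed
  moreover have "regularizes ?F [:L:]"
    unfolding regularizes_def
  proof
    show R: "fps_conv_radius ?F \<ge> 1" by (rule conv_radius_ge_1[OF F])
    define z where "z = (\<lambda>t. of_real (1 - exp (- t)) :: complex)"
    \<comment> \<open>With z = \<open>z t\<close>, the error D(z) / (1 - a z) - S / (1 - a) is put
      over the common denominator \<open>(1 - a z) (1 - a)\<close>; its numerator is
      \<open>(1 - a) (D(z) - S) + S a (z - 1)\<close>, two rapidly decaying terms.\<close>
    define g where "g = (\<lambda>t. inverse ((1 - a * z t) * (1 - a)))"
    define h1 where "h1 = (\<lambda>t. eval_fps D (z t) - S)"
    have "((\<lambda>t::real. 1 - exp (- t)) \<longlongrightarrow> 1 - 0) at_top"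
      by (intro tendsto_intros filterlim_compose[OF exp_at_bot] filterlim_uminus_at_bot_at_top)
    then have "(z \<longlongrightarrow> of_real (1 - 0)) at_top"
      unfolding z_def by (rule tendsto_of_real)
    then have g: "(g \<longlongrightarrow> inverse ((1 - a * of_real (1 - 0)) * (1 - a))) at_top"
      unfolding g_def using a by (intro tendsto_intros) auto
    have h1: "rapid_decay h1"
    proof (rule rapid_decay_exp_bound)
      fix t :: real assume "t > 0"
      then have "norm (h1 t) \<le> K * (1 - (1 - exp (- t))) powr (1/4)"
        unfolding h1_def z_def S_def by (intro K(2)) auto
      then show "norm (h1 t) \<le> K * exp (- (t / 4))"
        by (simp add: exp_powr_real)
    qed
    have h2: "rapid_decay (\<lambda>t. z t - 1)"
    proof (rule rapid_decay_exp_bound)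
      fix t :: real assume "t > 0"
      have "norm (z t - 1) = exp (- t)"
        by (simp add: z_def)
      then show "norm (z t - 1) \<le> 1 * exp (- (t / 4))" using \<open>t > 0\<close> by simp
    qed
    have "rapid_decay (\<lambda>t. ((1 - a) * h1 t + (S * a) * (z t - 1)) * g t)"
      by (rule rapid_decay_mult_tendsto[OF _ g]) (intro rapid_decay_add rapid_decay_cmult h1 h2)
    then have "rapid_decay (\<lambda>t. eval_fps ?F (z t) - poly [:L:] (of_real t))"
    proof (rule rapid_decay_cong[rotated])
      fix t :: real assume t: "t > 0"
      have nz: "norm (z t) < 1"
        using t unfolding z_def by (simp only: norm_of_real) simp
      have "eval_fps D (z t) = eval_fps (1 - fps_const a * fps_X) (z t) * eval_fps ?F (z t)"
        unfolding D_def z_def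
        by (intro eval_fps_mult in_conv_disc t R order_trans[OF _ fps_conv_radius_diff])
          (simp_all add: order_trans[OF _ fps_conv_radius_mult])
      also have "eval_fps (1 - fps_const a * fps_X) (z t) = 1 - a * z t"
        by (subst eval_fps_diff) (auto simp: eval_fps_mult less_le_trans[OF _ fps_conv_radius_mult])
      finally have e: "eval_fps D (z t) = (1 - a * z t) * eval_fps ?F (z t)" .
      have ne: "1 - a * z t \<noteq> 0"
      proof
        assume "1 - a * z t = 0"
        then have "norm (a * z t) = 1" by (metis eq_iff_diff_eq_0 norm_one)
        moreover have "norm (a * z t) < 1"
          using a(2) nz by (auto simp: letters_def norm_mult)
        ultimately show False by simp
      qed
      show "((1 - a) * h1 t + (S * a) * (z t - 1)) * g t = eval_fps ?F (z t) - poly [:L:] (of_real t)"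
      proof -
        have S: "S = L * (1 - a)" using a by (simp add: L_def)
        have "(1 - a) * h1 t + (S * a) * (z t - 1) = (eval_fps ?F (z t) - L) * ((1 - a * z t) * (1 - a))"
          unfolding h1_def e S by (simp add: algebra_simps)
        moreover have "(1 - a * z t) * (1 - a) * g t = 1"
          unfolding g_def using ne a by (intro right_inverse) simp
        ultimately show ?thesis by (simp add: mult.assoc)
      qed
    qed
    then show "rapid_decay (\<lambda>t. eval_fps ?F (of_real (1 - exp (- t))) - poly [:L:] (of_real t))"
      by (simp add: z_def)
  qed
  ultimately show thesis using that by blast
qed

section \<open>Reduction of words with leading letters \<open>x\<^sub>1\<close>\<close>

lemma shuf_sum_rel:
  assumes "\<And>w. w \<in> shuffles u v \<Longrightarrow> R (\<phi> w) (\<psi> w)"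
    and "\<And>x x' y y'. R x x' \<Longrightarrow> R y y' \<Longrightarrow> R (x + y) (x' + y')"
  shows "R (shuf_sum \<phi> u v) (shuf_sum \<psi> u v)"
  using assms(1)
proof (induction u v arbitrary: \<phi> \<psi> rule: shuffles.induct)
  case (3 a u b v)
  have "R (shuf_sum (\<lambda>w. \<phi> (a # w)) u (b # v)) (shuf_sum (\<lambda>w. \<psi> (a # w)) u (b # v))"
    by (rule "3.IH"(1)) (simp add: "3.prems")
  moreover have "R (shuf_sum (\<lambda>w. \<phi> (b # w)) (a # u) v) (shuf_sum (\<lambda>w. \<psi> (b # w)) (a # u) v)"
    by (rule "3.IH"(2)) (simp add: "3.prems")
  ultimately show ?case by (simp add: assms(2))
qed auto

text \<open>A letter inserted among the n leading copies of itself gives the same word n + 1 times;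
  otherwise it lands behind the first letter of \<open>w\<close>.\<close>

lemma shuf_sum_leading:
  fixes \<phi> :: "'a list \<Rightarrow> 'b::comm_ring_1"
  shows "shuf_sum \<phi> [a] (replicate n a @ w) = of_nat (Suc n) * \<phi> (replicate (Suc n) a @ w) +
     (case w of [] \<Rightarrow> 0 | b # v \<Rightarrow> shuf_sum (\<lambda>x. \<phi> (replicate n a @ b # x)) [a] v)"
proof (induction n arbitrary: \<phi>)
  case 0
  then show ?case by (cases w) auto
next
  case (Suc n)
  show ?case
    using Suc[of "\<lambda>x. \<phi> (a # x)"] by (cases w) (simp_all add: algebra_simps)
qed

text \<open>Solves \<open>shuf_sum_leading\<close> for the word with n + 1 leading letters; the
  closure of \<open>V\<close> under division by n + 1 is what permits this. It yields existence of
  the regularization with \<open>V\<close> the regularizable series, and uniqueness with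
  \<open>V = {0}\<close>.\<close>

lemma leading_letter_induct:
  fixes \<phi> :: "'a list \<Rightarrow> 'b::comm_ring_1"
  assumes base: "\<And>w. w \<in> S \<Longrightarrow> (w \<noteq> [] \<Longrightarrow> hd w \<noteq> a) \<Longrightarrow> \<phi> w \<in> V"
    and step: "\<And>w. w \<in> S \<Longrightarrow> \<phi> w \<in> V \<Longrightarrow> shuf_sum \<phi> [a] w \<in> V"
    and V: "0 \<in> V" "\<And>x y. x \<in> V \<Longrightarrow> y \<in> V \<Longrightarrow> x + y \<in> V" "\<And>x y. x \<in> V \<Longrightarrow> y \<in> V \<Longrightarrow> x - y \<in> V"
      "\<And>n x. of_nat (Suc n) * x \<in> V \<Longrightarrow> x \<in> V"
    and S: "\<And>w. a # w \<in> S \<Longrightarrow> w \<in> S"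
      "\<And>u v x. a # u @ v \<in> S \<Longrightarrow> x \<in> shuffles [a] v \<Longrightarrow> u @ x \<in> S"
    and w: "w \<in> S"
  shows "\<phi> w \<in> V"
proof -
  \<comment> \<open>The tail \<open>w\<close> stays arbitrary: inserting \<open>a\<close> behind
    \<open>replicate n a @ [b]\<close> changes the tail but, as \<open>b\<close> differs from
    \<open>a\<close>, leaves exactly n leading letters.\<close>
  have gen: "\<phi> (replicate n a @ w) \<in> V"
    if "replicate n a @ w \<in> S" "w \<noteq> [] \<Longrightarrow> hd w \<noteq> a" for n w
    using that
  proof (induction n arbitrary: w)
    case 0
    then show ?case using base by simp
  next
    case (Suc n)
    let ?rest = "case w of [] \<Rightarrow> 0 | b # v \<Rightarrow> shuf_sum (\<lambda>x. \<phi> (replicate n a @ b # x)) [a] v"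
    have s: "replicate n a @ w \<in> S" using S(1) Suc.prems(1) by simp
    have "?rest \<in> V"
    proof (cases w)
      case (Cons b v)
      have "shuf_sum (\<lambda>x. \<phi> (replicate n a @ b # x)) [a] v \<in> V"
      proof (rule shuf_sum_rel[where R = "\<lambda>x _. x \<in> V"])
        fix x assume "x \<in> shuffles [a] v"
        then have "(replicate n a @ [b]) @ x \<in> S"
          using S(2)[of "replicate n a @ [b]" v] Suc.prems(1) by (simp add: Cons)
        then show "\<phi> (replicate n a @ b # x) \<in> V"
          using Suc.prems(2) by (intro Suc.IH) (auto simp: Cons)
      qed (rule V(2))
      then show ?thesis by (simp add: Cons)
    qed (simp add: V(1))
    moreover have "shuf_sum \<phi> [a] (replicate n a @ w) \<in> V"
      using step[OF s] Suc.IH[OF s Suc.prems(2)] by blast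
    ultimately have "shuf_sum \<phi> [a] (replicate n a @ w) - ?rest \<in> V" using V(3) by blast
    also have "shuf_sum \<phi> [a] (replicate n a @ w) - ?rest = of_nat (Suc n) * \<phi> (replicate (Suc n) a @ w)"
      by (simp only: shuf_sum_leading add_diff_cancel_right')
    finally show ?case by (rule V(4))
  qed
  have "takeWhile ((=) a) w = replicate (length (takeWhile ((=) a) w)) a"
    by (rule replicate_eqI) (auto dest: set_takeWhileD)
  then have "w = replicate (length (takeWhile ((=) a) w)) a @ dropWhile ((=) a) w"
    by (metis takeWhile_dropWhile_id)
  moreover have "dropWhile ((=) a) w \<noteq> [] \<Longrightarrow> hd (dropWhile ((=) a) w) \<noteq> a"
    using hd_dropWhile by metis
  ultimately show ?thesis using gen w by metis
qed

definition reg_value :: "complex list \<Rightarrow> complex poly" where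
  "reg_value w = (THE P. regularizes (polylog w) P)"

lemma regularizes_reg_value:
  assumes "set w \<subseteq> letters"
  shows "regularizes (polylog w) (reg_value w)"
proof -
  \<comment> \<open>Shuffling with \<open>x\<^sub>1\<close> preserves this set because on series it
    is multiplication by \<open>polylog [1]\<close>.\<close>
  have "polylog w \<in> {F. \<exists>P. regularizes F P}"
  proof (rule leading_letter_induct[where S = "{w. set w \<subseteq> letters}" and a = 1 and \<phi> = polylog])
    fix w assume "w \<in> {w. set w \<subseteq> letters}" "w \<noteq> [] \<Longrightarrow> hd w \<noteq> (1::complex)"
    then show "polylog w \<in> {F. \<exists>P. regularizes F P}"
      using polylog_not1_regularizes[of w] by blast
  next
    fix w :: "complex list" assume "polylog w \<in> {F. \<exists>P. regularizes F P}"
    then show "shuf_sum polylog [1] w \<in> {F. \<exists>P. regularizes F P}"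
      using regularizes_mult[OF regularizes_polylog_1] by (auto simp: polylog_shuffle)
  next
    fix F G :: "complex fps"
    assume FG: "F \<in> {F. \<exists>P. regularizes F P}" "G \<in> {F. \<exists>P. regularizes F P}"
    then show "F + G \<in> {F. \<exists>P. regularizes F P}" using regularizes_add by blast
    from FG obtain P Q where "regularizes F P" "regularizes G Q" by blast
    then have "regularizes (F + fps_const (-1) * G) (P + [:-1:] * Q)"
      by (intro regularizes_add regularizes_mult regularizes_const)
    then show "F - G \<in> {F. \<exists>P. regularizes F P}"
      by (auto simp flip: fps_const_neg)
  next
    fix n and F :: "complex fps" assume "of_nat (Suc n) * F \<in> {F. \<exists>P. regularizes F P}"
    then obtain P where "regularizes (of_nat (Suc n) * F) P" by blast
    then have "regularizes (fps_const (1 / of_nat (Suc n)) * (of_nat (Suc n) * F)) ([:1 / of_nat (Suc n):] * P)"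
      by (intro regularizes_mult regularizes_const)
    moreover have "fps_const (1 / of_nat (Suc n)) * (of_nat (Suc n) * F) = F"
      by (simp only: mult.assoc[symmetric] fps_of_nat[symmetric] fps_const_mult) (simp del: of_nat_Suc)
    ultimately show "F \<in> {F. \<exists>P. regularizes F P}" unfolding mem_Collect_eq by metis
  next
    fix u v x :: "complex list"
    assume "1 # u @ v \<in> {w. set w \<subseteq> letters}" "x \<in> shuffles [1] v"
    then show "u @ x \<in> {w. set w \<subseteq> letters}" by (simp add: set_shuffles)
  next
    show "0 \<in> {F. \<exists>P. regularizes F P}" using regularizes_0 by blast
  qed (use assms in auto)
  then obtain P where "regularizes (polylog w) P" by blast
  then have "\<exists>!P. regularizes (polylog w) P" using regularizes_unique by blast
  then show ?thesis unfolding reg_value_def by (rule theI')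
qed

lemma reg_value_eqI: "set w \<subseteq> letters \<Longrightarrow> regularizes (polylog w) P \<Longrightarrow> reg_value w = P"
  using regularizes_unique regularizes_reg_value by blast

lemma reg_value_shuffle:
  assumes "set u \<subseteq> letters" "set v \<subseteq> letters"
  shows "shuf_sum reg_value u v = reg_value u * reg_value v"
proof (rule regularizes_unique)
  show "regularizes (shuf_sum polylog u v) (shuf_sum reg_value u v)"
    by (rule shuf_sum_rel[where R = regularizes])
      (use assms in \<open>simp_all add: set_shuffles regularizes_reg_value regularizes_add\<close>)
  show "regularizes (shuf_sum polylog u v) (reg_value u * reg_value v)"
    unfolding polylog_shuffle using assms by (intro regularizes_mult regularizes_reg_value)
qed

lemma reg_value_Nil [simp]: "reg_value [] = 1"
  by (rule reg_value_eqI) simp_all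

lemma reg_value_1: "reg_value [1] = [:0, 1:]"
  by (rule reg_value_eqI) (simp_all add: regularizes_polylog_1 letters_def)

section \<open>Colored multiple zeta values\<close>

lemma decreasing_lists_Suc:
  "{ks. length ks = Suc d \<and> sorted_wrt (>) ks \<and> set ks \<subseteq> {1..n}} =
     (\<lambda>(k, ks). k # ks) ` (SIGMA k:{1..n::nat}. {ks. length ks = d \<and> sorted_wrt (>) ks \<and> set ks \<subseteq> {1..k - 1}})"
proof (intro set_eqI iffI)
  fix ks assume "ks \<in> {ks. length ks = Suc d \<and> sorted_wrt (>) ks \<and> set ks \<subseteq> {1..n}}"
  then show "ks \<in> (\<lambda>(k, ks). k # ks) ` (SIGMA k:{1..n}. {ks. length ks = d \<and> sorted_wrt (>) ks \<and> set ks \<subseteq> {1..k - 1}})"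
    by (cases ks) (fastforce simp: image_iff)+
next
  fix ks assume "ks \<in> (\<lambda>(k, ks). k # ks) ` (SIGMA k:{1..n}. {ks. length ks = d \<and> sorted_wrt (>) ks \<and> set ks \<subseteq> {1..k - 1}})"
  then show "ks \<in> {ks. length ks = Suc d \<and> sorted_wrt (>) ks \<and> set ks \<subseteq> {1..n}}"
    by fastforce
qed

lemma cmzv_partial_Nil: "cmzv_partial [] n = 1"
proof -
  have "{ks::nat list. length ks = 0 \<and> sorted_wrt (>) ks \<and> set ks \<subseteq> {1..n}} = {[]}" by auto
  then show ?thesis by (simp add: cmzv_partial_def)
qed

lemma cmzv_partial_Cons:
  "cmzv_partial (p # ps) n =
     (\<Sum>k=1..n. snd p ^ k / of_nat k ^ fst p * cmzv_partial ps (k - 1))"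
proof -
  have fin: "finite {ks::nat list. length ks = d \<and> sorted_wrt (>) ks \<and> set ks \<subseteq> {1..m}}" for d m
    by (rule finite_subset[OF _ finite_lists_length_eq[of "{1..m}" d]]) auto
  have "cmzv_partial (p # ps) n =
      (\<Sum>(k, ks)\<in>(SIGMA k:{1..n}. {ks. length ks = length ps \<and> sorted_wrt (>) ks \<and> set ks \<subseteq> {1..k - 1}}).
        \<Prod>i<Suc (length ps). snd ((p # ps) ! i) ^ ((k # ks) ! i) / of_nat ((k # ks) ! i) ^ fst ((p # ps) ! i))"
    unfolding cmzv_partial_def length_Cons decreasing_lists_Suc
    by (subst sum.reindex) (auto simp: inj_on_def case_prod_unfold)
  also have "\<dots> = (\<Sum>k=1..n. \<Sum>ks | length ks = length ps \<and> sorted_wrt (>) ks \<and> set ks \<subseteq> {1..k - 1}.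
      \<Prod>i<Suc (length ps). snd ((p # ps) ! i) ^ ((k # ks) ! i) / of_nat ((k # ks) ! i) ^ fst ((p # ps) ! i))"
    by (subst sum.Sigma) (use fin in auto)
  also have "\<dots> = (\<Sum>k=1..n. snd p ^ k / of_nat k ^ fst p * cmzv_partial ps (k - 1))"
    by (simp add: prod.lessThan_Suc_shift cmzv_partial_def sum_distrib_left del: prod.lessThan_Suc)
  finally show ?thesis .
qed

text \<open>For a word not ending in 0 the subtracted term of \<open>polylog\<close> vanishes, and
  each leading 0 is a mere inversion of \<open>euler_op\<close>.\<close>

lemma fps_nth_polylog_zeros:
  assumes "w \<noteq> []" "last w \<noteq> 0" "n \<noteq> 0"
  shows "fps_nth (polylog (replicate k 0 @ w)) n = fps_nth (polylog w) n / of_nat n ^ k"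
proof (induction k)
  case (Suc k)
  have "fps_nth (polylog (replicate (Suc k) 0 @ w)) n = fps_nth (polylog (replicate k 0 @ w)) n / of_nat n"
    using assms by (simp add: polylog.simps(2) zero_kernel_def)
  with Suc show ?case by simp
qed simp

lemma fps_nth_polylog_letter:
  assumes "a \<noteq> 0" "w \<noteq> [] \<longrightarrow> last w \<noteq> 0" "n \<noteq> 0"
  shows "fps_nth (polylog (a # w)) n = (\<Sum>l<n. a ^ (n - l) * fps_nth (polylog w) l) / of_nat n"
proof -
  have "fps_nth (zero_kernel a * polylog w) n = (\<Sum>i=0..n. fps_nth (polylog w) i * fps_nth (zero_kernel a) (n - i))"
    by (simp add: mult.commute[of "zero_kernel a"] fps_mult_nth)
  also have "\<dots> = (\<Sum>l<n. a ^ (n - l) * fps_nth (polylog w) l)"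
    using assms(1) by (simp add: atLeast0AtMost lessThan_Suc_atMost[symmetric] zero_kernel_def mult.commute)
  finally show ?thesis using assms by (auto simp: polylog.simps(2))
qed

lemma last_yword: "ps \<in> indices N \<Longrightarrow> N \<ge> 1 \<Longrightarrow> yword ps \<noteq> [] \<longrightarrow> last (yword ps) \<noteq> 0"
proof (induction ps)
  case (Cons p ps)
  then have "ps \<in> indices N" "snd p \<noteq> 0" using roots_of_unity_nonzero by (auto simp: indices_def)
  with Cons show ?case by (cases p) (auto simp: yword_def)
qed (simp add: yword_def)

text \<open>Peeling off a pair (s, a) leaves a^(m - l) = a^m / a^l, and the weight 1 / a^l belongs
  to the remaining index with initial value \<open>a\<close>; hence the general \<open>c\<close>.
  For c = 1 the multiple zeta value becomes the sum of the coefficients.\<close>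

lemma cmzv_partial_ratios:
  assumes "N \<ge> 1" "ps \<in> indices N" "c \<noteq> 0"
  shows "cmzv_partial (ratios_from c ps) n = (\<Sum>m\<le>n. fps_nth (polylog (yword ps)) m / c ^ m)"
  using assms(2,3)
proof (induction ps arbitrary: c n)
  case Nil
  have "(\<Sum>m\<le>n. fps_nth 1 m / c ^ m) = (\<Sum>m\<in>{0::nat}. fps_nth 1 m / c ^ m)"
    by (rule sum.mono_neutral_right) auto
  then show ?case by (simp add: cmzv_partial_Nil yword_def)
next
  case (Cons p ps)
  obtain s a where p: "p = (s, a)" by (cases p)
  from Cons.prems have ps: "ps \<in> indices N" and s: "s \<ge> 1" and a: "a \<noteq> 0"
    using roots_of_unity_nonzero[OF assms(1)] by (auto simp: indices_def p)
  note last = last_yword[OF ps assms(1)]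
  have nth: "fps_nth (polylog (yword (p # ps))) m / c ^ m =
      (a / c) ^ m / of_nat m ^ s * (\<Sum>l\<le>m - 1. fps_nth (polylog (yword ps)) l / a ^ l)"
    if m: "m \<ge> 1" for m
  proof -
    have w: "yword (p # ps) = replicate (s - 1) 0 @ a # yword ps" by (simp add: yword_def p)
    have "fps_nth (polylog (yword (p # ps))) m =
        (\<Sum>l<m. a ^ (m - l) * fps_nth (polylog (yword ps)) l) / of_nat m / of_nat m ^ (s - 1)"
      unfolding w using a last m
      by (subst fps_nth_polylog_zeros) (auto simp: fps_nth_polylog_letter)
    also have "\<dots> = (\<Sum>l<m. a ^ (m - l) * fps_nth (polylog (yword ps)) l) / of_nat m ^ s"
      using s by (cases s) auto
    also have "(\<Sum>l<m. a ^ (m - l) * fps_nth (polylog (yword ps)) l) =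
        a ^ m * (\<Sum>l\<le>m - 1. fps_nth (polylog (yword ps)) l / a ^ l)"
    proof -
      have "{..<m} = {..m - 1}" using m by auto
      moreover have "a ^ (m - l) * x = a ^ m * (x / a ^ l)" if "l \<le> m - 1" for l x
        using that m a by (simp add: power_diff)
      ultimately show ?thesis by (simp add: sum_distrib_left)
    qed
    finally show ?thesis by (simp add: power_divide)
  qed
  have "yword (p # ps) \<noteq> []" by (simp add: yword_def p)
  then have "(\<Sum>m\<le>n. fps_nth (polylog (yword (p # ps))) m / c ^ m) =
      (\<Sum>m=1..n. fps_nth (polylog (yword (p # ps))) m / c ^ m)"
    by (simp add: atMost_atLeast0 sum.atLeast_Suc_atMost polylog_nth_0)
  also have "\<dots> = (\<Sum>m=1..n. (a / c) ^ m / of_nat m ^ s * cmzv_partial (ratios_from a ps) (m - 1))"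
    by (rule sum.cong) (auto simp: nth Cons.IH[OF ps a])
  finally show ?case by (simp add: p cmzv_partial_Cons)
qed

lemma norm_root_of_unity:
  assumes "N \<ge> 1" "a \<in> roots_of_unity N"
  shows "norm a = 1"
proof -
  have "norm a ^ N = 1" using assms(2) by (metis (mono_tags, lifting) mem_Collect_eq norm_one norm_power roots_of_unity_def)
  then show ?thesis using power_eq_imp_eq_base[of "norm a" N 1] assms(1) by simp
qed

lemma words1_letters: "N \<ge> 1 \<Longrightarrow> w \<in> words1 N \<Longrightarrow> set w \<subseteq> letters"
  using norm_root_of_unity by (auto simp: words1_def letters_def)

lemma reg_value_convergent:
  assumes "N \<ge> 1" "ps \<in> indices N" "yword ps \<in> words0 N"
  shows "reg_value (yword ps) = [:cmzv (ratios ps):]"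
proof -
  have l: "set (yword ps) \<subseteq> letters" using assms words1_letters by (auto simp: words0_def)
  obtain L where L: "fps_nth (polylog (yword ps)) sums L" "regularizes (polylog (yword ps)) [:L:]"
    using polylog_not1_regularizes[OF l] assms(3) by (auto simp: words0_def)
  have "cmzv_partial (ratios ps) = (\<lambda>n. \<Sum>m\<le>n. fps_nth (polylog (yword ps)) m)"
    using assms by (simp add: fun_eq_iff ratios_def cmzv_partial_ratios)
  with L(1) have "cmzv_partial (ratios ps) \<longlonglongrightarrow> L" by (simp add: sums_def_le)
  then have "cmzv (ratios ps) = L" by (simp add: cmzv_def limI)
  then show ?thesis using reg_value_eqI[OF l L(2)] by simp
qed

section \<open>The Lie series behind the symmetrized values\<close>

text \<open>The deconcatenation coproduct paired with \<alpha>: for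
  \<open>\<alpha> P Q = f P * g Q\<close> this is the coefficient of the word in a product of two
  series.\<close>

fun split_sum :: "('a list \<Rightarrow> 'a list \<Rightarrow> 'b::comm_monoid_add) \<Rightarrow> 'a list \<Rightarrow> 'b" where
  "split_sum \<alpha> [] = \<alpha> [] []"
| "split_sum \<alpha> (a # w) = \<alpha> [] (a # w) + split_sum (\<lambda>P Q. \<alpha> (a # P) Q) w"

lemma split_sum_cong:
  "(\<And>P Q. w = P @ Q \<Longrightarrow> \<alpha> P Q = \<beta> P Q) \<Longrightarrow> split_sum \<alpha> w = split_sum \<beta> w"
proof (induction w arbitrary: \<alpha> \<beta>)
  case (Cons a w)
  have "split_sum (\<lambda>P Q. \<alpha> (a # P) Q) w = split_sum (\<lambda>P Q. \<beta> (a # P) Q) w"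
    by (rule Cons.IH) (simp add: Cons.prems)
  then show ?case by (simp add: Cons.prems)
qed simp

lemma split_sum_add:
  "split_sum (\<lambda>P Q. \<alpha> P Q + \<beta> P Q) w = split_sum \<alpha> w + split_sum \<beta> w"
proof (induction w arbitrary: \<alpha> \<beta>)
  case (Cons a w)
  show ?case by (simp only: split_sum.simps Cons.IH) (simp add: ac_simps)
qed simp

lemma split_sum_0 [simp]: "split_sum (\<lambda>P Q. 0) w = 0"
  by (induction w) auto

lemma split_sum_cmult:
  fixes c :: "'b::semiring_0"
  shows "split_sum (\<lambda>P Q. c * \<alpha> P Q) w = c * split_sum \<alpha> w"
proof (induction w arbitrary: \<alpha>)
  case (Cons a w)
  show ?case by (simp only: split_sum.simps Cons.IH distrib_left)
qed simp

lemma split_sum_swap: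
  "split_sum (\<lambda>P Q. split_sum (\<lambda>P' Q'. \<alpha> P Q P' Q') v) u =
   split_sum (\<lambda>P' Q'. split_sum (\<lambda>P Q. \<alpha> P Q P' Q') u) v"
proof (induction u arbitrary: \<alpha>)
  case (Cons a u)
  show ?case by (simp only: split_sum.simps Cons.IH split_sum_add)
qed simp

text \<open>A prefix of a shuffle is a shuffle of prefixes, and the rest a shuffle of the matching
  suffixes: deconcatenation is multiplicative in the shuffle bialgebra.\<close>

lemma split_sum_shuffle:
  "shuf_sum (split_sum \<alpha>) u v =
     split_sum (\<lambda>u1 u2. split_sum (\<lambda>v1 v2. shuf_sum (\<lambda>P. shuf_sum (\<alpha> P) u2 v2) u1 v1) v) u"
proof (induction u v arbitrary: \<alpha> rule: shuffles.induct)
  case (1 v)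
  have "(\<lambda>P. shuf_sum (\<alpha> P) []) = \<alpha>" by (simp add: fun_eq_iff)
  then show ?case by simp
next
  case (3 a u b v)
  have "shuf_sum (split_sum \<alpha>) (a # u) (b # v) =
      (shuf_sum (\<lambda>w. \<alpha> [] (a # w)) u (b # v) + shuf_sum (\<lambda>w. \<alpha> [] (b # w)) (a # u) v) +
      (shuf_sum (split_sum (\<lambda>P. \<alpha> (a # P))) u (b # v) +
       shuf_sum (split_sum (\<lambda>P. \<alpha> (b # P))) (a # u) v)"
    by (simp add: shuf_sum_add ac_simps)
  also note "3.IH"(1) also note "3.IH"(2)
  finally show ?case by (simp add: split_sum_add ac_simps)
qed simp_all

text \<open>The alternating sum telescopes: each shuffle of a reversed prefix with a suffix is split
  according to its first letter.\<close>

lemma split_sum_antipode_aux: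
  fixes \<phi> :: "'a list \<Rightarrow> 'b::comm_ring_1"
  shows "split_sum (\<lambda>P Q. (- 1) ^ length P * shuf_sum \<phi> (rev P @ c # R) Q) w =
     shuf_sum (\<lambda>x. \<phi> (c # x)) R w"
proof (induction w arbitrary: c R)
  case (Cons d w)
  have "split_sum (\<lambda>P Q. (- 1) ^ length (d # P) * shuf_sum \<phi> (rev (d # P) @ c # R) Q) w =
      split_sum (\<lambda>P Q. - 1 * ((- 1) ^ length P * shuf_sum \<phi> (rev P @ d # (c # R)) Q)) w"
    by simp
  also have "\<dots> = - shuf_sum (\<lambda>x. \<phi> (d # x)) (c # R) w"
    by (simp only: split_sum_cmult Cons.IH) simp
  finally show ?case by simp
qed simp

text \<open>Signed reversal is the antipode of the shuffle Hopf algebra: by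
  \<open>split_sum_antipode_aux\<close> the splittings with nonempty prefix add up to minus the term
  with empty prefix.\<close>

lemma split_sum_antipode:
  fixes \<phi> :: "'a list \<Rightarrow> 'b::comm_ring_1"
  assumes "w \<noteq> []"
  shows "split_sum (\<lambda>P Q. (- 1) ^ length P * shuf_sum \<phi> (rev P) Q) w = 0"
proof -
  obtain d w' where w: "w = d # w'" using assms by (cases w) auto
  have "split_sum (\<lambda>P Q. (- 1) ^ length (d # P) * shuf_sum \<phi> (rev (d # P)) Q) w' =
      split_sum (\<lambda>P Q. - 1 * ((- 1) ^ length P * shuf_sum \<phi> (rev P @ d # []) Q)) w'"
    by simp
  also have "\<dots> = - \<phi> (d # w')"
    by (simp only: split_sum_cmult split_sum_antipode_aux) simp
  finally show ?thesis by (simp add: w)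
qed

section \<open>The group-like series and the Lie series built from it\<close>

definition zeta_word :: "complex \<Rightarrow> complex list \<Rightarrow> complex" where
  "zeta_word T w = poly (reg_value w) T"

lemma zeta_word_shuffle:
  assumes "set u \<subseteq> letters" "set v \<subseteq> letters"
  shows "shuf_sum (zeta_word T) u v = zeta_word T u * zeta_word T v"
proof -
  have "shuf_sum (zeta_word T) u v = poly (shuf_sum reg_value u v) T"
    unfolding zeta_word_def by (rule shuf_sum_hom) simp
  then show ?thesis by (simp add: reg_value_shuffle assms zeta_word_def)
qed

text \<open>Cutting a word at the letter \<open>a\<close> restarts the partial products of the index
  on either side of the cut, which divides all letters by \<open>a\<close>.\<close>

definition rescale :: "complex \<Rightarrow> complex list \<Rightarrow> complex list" where
  "rescale a = map (\<lambda>x. x / a)"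

lemma rescale_letters:
  "a \<in> letters \<Longrightarrow> a \<noteq> 0 \<Longrightarrow> set w \<subseteq> letters \<Longrightarrow> set (rescale a w) \<subseteq> letters"
  by (auto simp: rescale_def letters_def norm_divide)

definition suffix_value :: "complex \<Rightarrow> complex \<Rightarrow> complex list \<Rightarrow> complex" where
  "suffix_value T a Q = zeta_word T (rescale a Q)"

text \<open>\<open>suffix_value T a\<close> composed with the antipode: the coefficients of the
  inverse series.\<close>

definition prefix_value :: "complex \<Rightarrow> complex \<Rightarrow> complex list \<Rightarrow> complex" where
  "prefix_value T a P = (- 1) ^ length P * zeta_word T (rescale a (rev P))"

lemma suffix_value_shuffle:
  assumes "a \<in> letters" "a \<noteq> 0" "set u \<subseteq> letters" "set v \<subseteq> letters"
  shows "shuf_sum (suffix_value T a) u v = suffix_value T a u * suffix_value T a v"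
proof -
  have "shuf_sum (suffix_value T a) u v = shuf_sum (zeta_word T) (rescale a u) (rescale a v)"
    unfolding suffix_value_def rescale_def by (rule shuf_sum_map)
  then show ?thesis
    using assms by (simp add: zeta_word_shuffle rescale_letters suffix_value_def)
qed

lemma prefix_value_shuffle:
  assumes "a \<in> letters" "a \<noteq> 0" "set u \<subseteq> letters" "set v \<subseteq> letters"
  shows "shuf_sum (prefix_value T a) u v = prefix_value T a u * prefix_value T a v"
proof -
  have "shuf_sum (prefix_value T a) u v =
      shuf_sum (\<lambda>P. (- 1) ^ (length u + length v) * suffix_value T a (rev P)) u v"
    by (rule shuf_sum_cong) (simp add: prefix_value_def suffix_value_def length_shuffles)
  also have "\<dots> = (- 1) ^ (length u + length v) * shuf_sum (suffix_value T a) (rev u) (rev v)"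
    by (simp only: shuf_sum_mult_left shuf_sum_rev)
  finally show ?thesis
    using assms by (simp add: suffix_value_shuffle) (simp add: suffix_value_def prefix_value_def power_add)
qed

text \<open>The inverse series times the series is 1. Multiplicativity of
  \<open>suffix_value\<close> merges each product into a sum over shuffles, to which the antipode
  identity applies.\<close>

lemma prefix_suffix_convolution:
  assumes "a \<in> letters" "a \<noteq> 0" "set w \<subseteq> letters" "w \<noteq> []"
  shows "split_sum (\<lambda>P Q. prefix_value T a P * suffix_value T a Q) w = 0"
proof -
  have "split_sum (\<lambda>P Q. prefix_value T a P * suffix_value T a Q) w =
      split_sum (\<lambda>P Q. (- 1) ^ length P * shuf_sum (suffix_value T a) (rev P) Q) w"
  proof (rule split_sum_cong)
    fix P Q assume "w = P @ Q"
    then show "prefix_value T a P * suffix_value T a Q =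
        (- 1) ^ length P * shuf_sum (suffix_value T a) (rev P) Q"
      using assms by (subst suffix_value_shuffle) (auto simp: suffix_value_def prefix_value_def)
  qed
  then show ?thesis using split_sum_antipode[OF assms(4)] by simp
qed

text \<open>Makes a cut at a letter an instance of \<open>split_sum\<close>: the letter is the head
  of the second part. The default 0 discards an empty second part and the letter 0, where no cut is
  made.\<close>

definition at_letter :: "(complex list \<Rightarrow> complex \<Rightarrow> complex list \<Rightarrow> complex) \<Rightarrow>
    complex list \<Rightarrow> complex list \<Rightarrow> complex" where
  "at_letter h P Q = (case Q of [] \<Rightarrow> 0 | a # Q' \<Rightarrow> if a = 0 then 0 else h P a Q')"

definition cut_term :: "complex \<Rightarrow> complex list \<Rightarrow> complex \<Rightarrow> complex list \<Rightarrow> complex" where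
  "cut_term T P a Q = 1 / a * (prefix_value T a P * suffix_value T a Q)"

text \<open>In terms of the generating series \<open>\<Phi>\<^sub>a\<close> of \<^term>\<open>suffix_value T a\<close>, this is the coefficient
  of the word in the sum of \<open>a\<^sup>-\<^sup>1 \<Phi>\<^sub>a\<^sup>-\<^sup>1 x\<^sub>a \<Phi>\<^sub>a\<close> over the roots of unity \<open>a\<close>: a Lie series.\<close>

definition lie_coeff :: "complex \<Rightarrow> complex list \<Rightarrow> complex" where
  "lie_coeff T = split_sum (at_letter (cut_term T))"

text \<open>The letter of the cut comes from one of the two words; what follows it is shuffled with
  the whole other word.\<close>

lemma shuf_sum_at_letter:
  "shuf_sum (at_letter h P) u v =
     at_letter (\<lambda>P a x. shuf_sum (h P a) x v) P u + at_letter (\<lambda>P a x. shuf_sum (h P a) u x) P v"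
  by (cases u; cases v) (auto simp: at_letter_def)

lemma shuf_sum_shuf_sum_cut_term:
  assumes "a \<in> letters" "a \<noteq> 0" "set u1 \<subseteq> letters" "set v1 \<subseteq> letters"
    "set u2 \<subseteq> letters" "set v2 \<subseteq> letters"
  shows "shuf_sum (\<lambda>P. shuf_sum (cut_term T P a) u2 v2) u1 v1 =
     1 / a * ((prefix_value T a u1 * suffix_value T a u2) * (prefix_value T a v1 * suffix_value T a v2))"
  unfolding cut_term_def shuf_sum_mult_left shuf_sum_mult_right
  using assms by (simp add: suffix_value_shuffle prefix_value_shuffle)

text \<open>In the split shuffle the cut letter belongs to \<open>u\<close> (term \<open>A\<close>)
  or to \<open>v\<close> (term \<open>B\<close>). The word that does not contain it contributes its
  full convolution of prefix and suffix values, which is 0 because that word is nonempty.\<close>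

theorem lie_coeff_shuffle:
  assumes "set u \<subseteq> letters" "set v \<subseteq> letters" "u \<noteq> []" "v \<noteq> []"
  shows "shuf_sum (lie_coeff T) u v = 0"
proof -
  define pv where "pv a v1 v2 = prefix_value T a v1 * suffix_value T a v2" for a v1 v2
  define A where "A = (\<lambda>u1 u2 v1 v2. at_letter (\<lambda>u1 a x. 1 / a * pv a u1 x * pv a v1 v2) u1 u2)"
  define B where "B = (\<lambda>u1 u2 v1 v2. at_letter (\<lambda>v1 a x. 1 / a * pv a v1 x * pv a u1 u2) v1 v2)"
  have X: "shuf_sum (\<lambda>P. shuf_sum (at_letter (cut_term T) P) u2 v2) u1 v1 = A u1 u2 v1 v2 + B u1 u2 v1 v2"
    if "u = u1 @ u2" "v = v1 @ v2" for u1 u2 v1 v2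
  proof -
    have l: "set u1 \<subseteq> letters" "set u2 \<subseteq> letters" "set v1 \<subseteq> letters" "set v2 \<subseteq> letters"
      using assms that by auto
    have "shuf_sum (\<lambda>P. at_letter (\<lambda>P a x. shuf_sum (cut_term T P a) x v2) P u2) u1 v1 = A u1 u2 v1 v2"
    proof (cases u2)
      case (Cons a x)
      then show ?thesis
        using l by (cases "a = 0") (auto simp: at_letter_def A_def pv_def shuf_sum_shuf_sum_cut_term)
    qed (simp add: at_letter_def A_def)
    moreover have "shuf_sum (\<lambda>P. at_letter (\<lambda>P a x. shuf_sum (cut_term T P a) u2 x) P v2) u1 v1 = B u1 u2 v1 v2"
    proof (cases v2)
      case (Cons a x)
      then show ?thesis
        using l by (cases "a = 0") (auto simp: at_letter_def B_def pv_def shuf_sum_shuf_sum_cut_term)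
    qed (simp add: at_letter_def B_def)
    ultimately show ?thesis by (simp add: shuf_sum_at_letter shuf_sum_add)
  qed
  have zero: "split_sum (\<lambda>w1 w2. at_letter (\<lambda>u1 a x. 1 / a * pv a u1 x * pv a w1 w2) u1 u2) w = 0"
    if "set u2 \<subseteq> letters" "set w \<subseteq> letters" "w \<noteq> []" for u1 u2 w
  proof (cases "u2 = [] \<or> hd u2 = 0")
    case True
    then show ?thesis by (cases u2) (simp_all add: at_letter_def)
  next
    case False
    then obtain a x where a: "u2 = a # x" "a \<noteq> 0" by (cases u2) auto
    then have "split_sum (\<lambda>w1 w2. (1 / a * pv a u1 x) * pv a w1 w2) w = 0"
      unfolding split_sum_cmult using that prefix_suffix_convolution[of a w T]
      by (simp add: pv_def)
    then show ?thesis using a by (simp add: at_letter_def)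
  qed
  have "shuf_sum (lie_coeff T) u v = split_sum (\<lambda>u1 u2. split_sum (\<lambda>v1 v2.
      A u1 u2 v1 v2 + B u1 u2 v1 v2) v) u"
    unfolding lie_coeff_def split_sum_shuffle
    by (intro split_sum_cong) (simp add: X)
  \<comment> \<open>The order of summation is exchanged in \<open>B\<close> so that the inner sum
    runs over the word without the cut letter.\<close>
  also have "\<dots> = split_sum (\<lambda>u1 u2. split_sum (\<lambda>v1 v2. A u1 u2 v1 v2) v) u +
      split_sum (\<lambda>v1 v2. split_sum (\<lambda>u1 u2. B u1 u2 v1 v2) u) v"
    by (simp only: split_sum_add) (simp only: split_sum_swap[of _ v u])
  also have "split_sum (\<lambda>u1 u2. split_sum (\<lambda>v1 v2. A u1 u2 v1 v2) v) u = split_sum (\<lambda>u1 u2. 0) u"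
    unfolding A_def by (rule split_sum_cong, rule zero) (use assms in auto)
  also have "split_sum (\<lambda>v1 v2. split_sum (\<lambda>u1 u2. B u1 u2 v1 v2) u) v = split_sum (\<lambda>v1 v2. 0) v"
    unfolding B_def by (rule split_sum_cong, rule zero) (use assms in auto)
  finally show ?thesis by simp
qed

text \<open>The Lie series kills the shuffle of \<open>replicate j 0 @ 1 # u\<close> and
  \<open>replicate k 0 @ 1 # v\<close>; sorting by the first letter links these relations for
  neighbouring j and k.\<close>

lemma lie_coeff_exchange:
  assumes "set u \<subseteq> letters" "set v \<subseteq> letters"
  shows "shuf_sum (\<lambda>w. lie_coeff T (1 # w)) (replicate n 0 @ 1 # u) v =
     (- 1) ^ Suc n * shuf_sum (\<lambda>w. lie_coeff T (1 # w)) u (replicate n 0 @ 1 # v)"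
proof -
  define r where "r j k = shuf_sum (\<lambda>w. lie_coeff T (0 # w)) (replicate j 0 @ 1 # u) (replicate k 0 @ 1 # v)"
    for j k
  have t: "shuf_sum (lie_coeff T) (replicate j 0 @ 1 # u) (replicate k 0 @ 1 # v) = 0" for j k
    by (rule lie_coeff_shuffle) (use assms in \<open>auto simp: letters_def\<close>)
  have step: "r j (Suc k) = - r (Suc j) k" for j k
    using t[of "Suc j" "Suc k"] by (simp add: r_def eq_neg_iff_add_eq_0)
  \<comment> \<open>Each zero moved from one word to the other changes the sign. The extreme cases
    \<open>r m 0\<close> and \<open>r 0 m\<close>, which give the two sides of the claim, thus
    differ by (-1)^m, which is (-1)^(Suc n) for n = Suc m.\<close>
  have r: "r j k = (- 1) ^ k * r (j + k) 0" for j k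
    by (induction k arbitrary: j) (simp_all add: step)
  show ?thesis
  proof (cases n)
    case 0
    then show ?thesis using t[of 0 0] by (simp add: add.commute add_eq_0_iff)
  next
    case (Suc m)
    have "shuf_sum (\<lambda>w. lie_coeff T (1 # w)) (replicate n 0 @ 1 # u) v = - r m 0"
      using t[of "Suc m" 0] by (simp add: Suc r_def add_eq_0_iff)
    moreover have "shuf_sum (\<lambda>w. lie_coeff T (1 # w)) u (replicate n 0 @ 1 # v) = - r 0 m"
      using t[of 0 "Suc m"] by (simp add: Suc r_def add_eq_0_iff2)
    moreover have "r 0 m = (- 1) ^ m * r m 0" using r[of 0 m] by simp
    moreover have "(- 1) ^ m * ((- 1) ^ m * r m 0) = r m 0"
      by (simp flip: mult.assoc power_mult_distrib)
    ultimately show ?thesis by (simp add: Suc)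
  qed
qed

lemma yword_Cons: "yword ((s, a) # ps) = replicate (s - 1) 0 @ a # yword ps"
  by (simp add: yword_def)

lemma yword_append: "yword (ps @ qs) = yword ps @ yword qs"
  by (simp add: yword_def)

lemma set_yword_letters: "snd ` set ps \<subseteq> letters \<Longrightarrow> set (yword ps) \<subseteq> letters"
  by (induction ps) (auto simp: yword_def letters_def)

text \<open>Iterating the exchange empties the left word: its blocks reach the right word in
  reversed order, and the signs (-1)^s multiply to that of the weight. This reproduces
  \<open>tau\<close>.\<close>

lemma lie_coeff_rev:
  assumes "us \<in> indices 1" "set v \<subseteq> letters"
  shows "shuf_sum (\<lambda>w. lie_coeff T (1 # w)) (yword us) v =
     (- 1) ^ weight us * lie_coeff T (1 # yword (rev us) @ v)"
  using assms
proof (induction us arbitrary: v)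
  case Nil
  then show ?case by (simp add: weight_def yword_def)
next
  case (Cons p us)
  \<comment> \<open>The only first root of unity is 1, so every block has the shape that
    \<open>lie_coeff_exchange\<close> moves.\<close>
  obtain s where p: "p = (s, 1)" and s: "s \<ge> 1" and us: "us \<in> indices 1"
    using Cons.prems(1) by (cases p) (auto simp: indices_def roots_of_unity_def)
  have "set (yword us) \<subseteq> letters"
    using us by (intro set_yword_letters) (auto simp: indices_def roots_of_unity_def letters_def)
  then have "shuf_sum (\<lambda>w. lie_coeff T (1 # w)) (yword (p # us)) v =
      (- 1) ^ Suc (s - 1) * shuf_sum (\<lambda>w. lie_coeff T (1 # w)) (yword us) (replicate (s - 1) 0 @ 1 # v)"
    unfolding p yword_Cons using Cons.prems(2) by (intro lie_coeff_exchange)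
  also have "shuf_sum (\<lambda>w. lie_coeff T (1 # w)) (yword us) (replicate (s - 1) 0 @ 1 # v) =
      (- 1) ^ weight us * lie_coeff T (1 # yword (rev us) @ replicate (s - 1) 0 @ 1 # v)"
    by (rule Cons.IH[OF us]) (use Cons.prems(2) in \<open>auto simp: letters_def\<close>)
  finally show ?case
    using s by (simp add: p weight_def yword_append yword_Cons power_add) (simp add: yword_def)
qed

section \<open>The shuffle regularization\<close>

definition lin_ext :: "(complex list \<Rightarrow> complex) \<Rightarrow> ncpoly \<Rightarrow> complex" where
  "lin_ext F f = (\<Sum>w\<in>Poly_Mapping.keys f. of_rat (Poly_Mapping.lookup f w) * F w)"

lemma lin_ext_superset:
  assumes "finite A" "Poly_Mapping.keys f \<subseteq> A"
  shows "lin_ext F f = (\<Sum>w\<in>A. of_rat (Poly_Mapping.lookup f w) * F w)"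
  unfolding lin_ext_def using assms
  by (intro sum.mono_neutral_left) (auto simp: in_keys_iff)

lemma lin_ext_add: "lin_ext F (f + g) = lin_ext F f + lin_ext F g"
proof -
  let ?A = "Poly_Mapping.keys f \<union> Poly_Mapping.keys g"
  have "Poly_Mapping.keys (f + g) \<subseteq> ?A" by (rule keys_add)
  then show ?thesis
    by (simp add: lin_ext_superset[of ?A] lookup_add of_rat_add distrib_right sum.distrib)
qed

lemma lin_ext_0 [simp]: "lin_ext F 0 = 0"
  by (simp add: lin_ext_def)

lemma lin_ext_sum: "lin_ext F (\<Sum>i\<in>I. f i) = (\<Sum>i\<in>I. lin_ext F (f i))"
  by (induction I rule: infinite_finite_induct) (simp_all add: lin_ext_add)

lemma keys_scale: "Poly_Mapping.keys (Defs.scale c f) \<subseteq> Poly_Mapping.keys f"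
  by (auto simp: in_keys_iff lookup_scale)

lemma lin_ext_scale: "lin_ext F (Defs.scale c f) = of_rat c * lin_ext F f"
  by (subst lin_ext_superset[OF _ keys_scale])
    (simp_all add: lin_ext_def lookup_scale of_rat_mult sum_distrib_left mult.assoc)

lemma lin_ext_word [simp]: "lin_ext F (word w) = F w"
  by (simp add: lin_ext_def word_def)

lemma ncpoly_expand:
  "f = (\<Sum>w\<in>Poly_Mapping.keys f. Defs.scale (Poly_Mapping.lookup f w) (word w))"
proof (rule poly_mapping_eqI)
  fix x
  have "Poly_Mapping.lookup (\<Sum>w\<in>Poly_Mapping.keys f. Defs.scale (Poly_Mapping.lookup f w) (word w)) x =
      (\<Sum>w\<in>Poly_Mapping.keys f. if w = x then Poly_Mapping.lookup f x else 0)"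
    unfolding lookup_sum
    by (rule sum.cong) (auto simp: lookup_scale word_def lookup_single when_def)
  then show "Poly_Mapping.lookup f x =
      Poly_Mapping.lookup (\<Sum>w\<in>Poly_Mapping.keys f. Defs.scale (Poly_Mapping.lookup f w) (word w)) x"
    by (simp add: in_keys_iff)
qed

lemma scale_conv_mult: "Defs.scale c f = Poly_Mapping.single 0 c * f"
  by (simp add: Defs.scale_def mult_map_scale_conv_mult)

lemma scale_mult_left: "Defs.scale c f * g = Defs.scale c (f * g)"
  by (simp add: scale_conv_mult mult.assoc)

lemma word_mult_scale: "word u * Defs.scale c g = Defs.scale c (word u * g)"
proof -
  have "word u * Poly_Mapping.single 0 c = Poly_Mapping.single 0 c * word u"
    by (simp add: word_def mult_single)
  then show ?thesis by (metis scale_conv_mult mult.assoc)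
qed

lemma lin_ext_word_mult: "lin_ext F (word u * f) = lin_ext (\<lambda>w. F (u @ w)) f"
proof -
  have "word u * f = word u * (\<Sum>w\<in>Poly_Mapping.keys f. Defs.scale (Poly_Mapping.lookup f w) (word w))"
    by (rule arg_cong[OF ncpoly_expand[of f], of "(*) (word u)"])
  also have "\<dots> = (\<Sum>w\<in>Poly_Mapping.keys f. Defs.scale (Poly_Mapping.lookup f w) (word (u @ w)))"
    by (simp only: sum_distrib_left word_mult_scale word_append)
  finally show ?thesis by (simp only: lin_ext_sum lin_ext_scale lin_ext_word) (simp only: lin_ext_def)
qed

text \<open>The bridge between shuffles as noncommutative polynomials and sums over
  shuffles.\<close>

lemma lin_ext_shuffle_words: "lin_ext F (shuffle_words u v) = shuf_sum F u v"
proof (induction u v arbitrary: F rule: shuffle_words.induct)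
  case (3 a u b v)
  have "lin_ext F (shuffle_words (a # u) (b # v)) =
      lin_ext (\<lambda>w. F (a # w)) (shuffle_words u (b # v)) + lin_ext (\<lambda>w. F (b # w)) (shuffle_words (a # u) v)"
    by (simp add: lin_ext_add lin_ext_word_mult)
  then show ?case by (simp only: "3.IH" shuf_sum.simps)
qed simp_all

lemma lin_ext_shuffle:
  "lin_ext F (shuffle f g) = (\<Sum>u\<in>Poly_Mapping.keys f. \<Sum>v\<in>Poly_Mapping.keys g.
     of_rat (Poly_Mapping.lookup f u * Poly_Mapping.lookup g v) * shuf_sum F u v)"
  by (simp add: shuffle_def lin_ext_sum lin_ext_scale lin_ext_shuffle_words)

lemma keys_letter_mult: "Poly_Mapping.keys (letter a * f) \<subseteq> (#) a ` Poly_Mapping.keys f"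
  using keys_mult[of "letter a" f] by (auto simp: word_def plus_list_def split: if_splits)

lemma keys_shuffle_words: "Poly_Mapping.keys (shuffle_words u v) \<subseteq> shuffles u v"
proof (induction u v rule: shuffle_words.induct)
  case (3 a u b v)
  have "Poly_Mapping.keys (shuffle_words (a # u) (b # v)) \<subseteq>
      Poly_Mapping.keys (letter a * shuffle_words u (b # v)) \<union> Poly_Mapping.keys (letter b * shuffle_words (a # u) v)"
    by (simp add: keys_add)
  also have "\<dots> \<subseteq> (#) a ` shuffles u (b # v) \<union> (#) b ` shuffles (a # u) v"
    by (intro Un_mono order_trans[OF keys_letter_mult] image_mono "3.IH")
  finally show ?case by simp
qed (simp_all add: word_def)

lemma shuffle_word_word: "shuffle (word u) (word v) = shuffle_words u v"
proof -
  have "Defs.scale 1 f = f" for f by (rule poly_mapping_eqI) (simp add: lookup_scale)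
  then show ?thesis by (simp add: shuffle_def word_def)
qed

section \<open>Existence and uniqueness of the regularization\<close>

lemma shuffles_words1:
  assumes "u \<in> words1 N" "v \<in> words1 N" "w \<in> shuffles u v"
  shows "w \<in> words1 N"
  using last_shuffles[OF assms(3)] assms set_shuffles[OF assms(3)] by (auto simp: words1_def)

lemma word_in_A1: "word w \<in> A1 N \<longleftrightarrow> w \<in> words1 N"
  by (simp add: A1_def word_def)

lemma one_in_words1: "[1] \<in> words1 N"
  by (simp add: words1_def roots_of_unity_def)

lemma is_shuffle_reg_reg_value:
  assumes "N \<ge> 1"
  shows "is_shuffle_reg N (\<lambda>f. \<Sum>w\<in>Poly_Mapping.keys f. smult (of_rat (Poly_Mapping.lookup f w)) (reg_value w))"
    (is "is_shuffle_reg N ?Z")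
proof -
  \<comment> \<open>Identities between polynomials are tested at every T, where \<open>?Z\<close>
    becomes a complex-valued linear extension.\<close>
  have Z: "poly (?Z f) T = lin_ext (zeta_word T) f" for f T
    by (simp add: poly_sum lin_ext_def zeta_word_def)
  have word: "?Z (word w) = reg_value w" for w
    by (simp add: word_def)
  show ?thesis
    unfolding is_shuffle_reg_def
  proof (intro conjI ballI allI impI)
    fix f g
    show "?Z (f + g) = ?Z f + ?Z g"
      by (simp only: poly_eq_poly_eq_iff[symmetric] fun_eq_iff poly_add Z lin_ext_add) simp
    assume fg: "f \<in> A1 N" "g \<in> A1 N"
    have l: "set w \<subseteq> letters" if "w \<in> Poly_Mapping.keys f \<or> w \<in> Poly_Mapping.keys g" for w
      using fg that words1_letters[OF assms] by (auto simp: A1_def)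
    have "lin_ext (zeta_word T) (shuffle f g) = lin_ext (zeta_word T) f * lin_ext (zeta_word T) g" for T
      unfolding lin_ext_shuffle unfolding lin_ext_def sum_product
      by (intro sum.cong) (simp_all add: l zeta_word_shuffle of_rat_mult)
    then show "?Z (shuffle f g) = ?Z f * ?Z g"
      by (simp only: poly_eq_poly_eq_iff[symmetric] fun_eq_iff poly_mult Z) simp
  next
    fix c f
    show "?Z (Defs.scale c f) = smult (of_rat c) (?Z f)"
      by (simp only: poly_eq_poly_eq_iff[symmetric] fun_eq_iff poly_smult Z lin_ext_scale) simp
  next
    show "?Z 1 = 1" using word[of "[]"] by (simp add: word_Nil)
    show "?Z (letter 1) = [:0, 1:]" by (simp only: word reg_value_1)
  next
    fix ps assume "ps \<in> indices N" "yword ps \<in> words0 N"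
    then show "?Z (word (yword ps)) = [:cmzv (ratios ps):]"
      by (simp only: word reg_value_convergent[OF assms])
  qed
qed

lemma is_shuffle_reg_expand:
  assumes Z: "is_shuffle_reg N Z" and f: "f \<in> A1 N"
  shows "Z f = (\<Sum>w\<in>Poly_Mapping.keys f. smult (of_rat (Poly_Mapping.lookup f w)) (Z (word w)))"
proof -
  have add: "\<And>f g. f \<in> A1 N \<Longrightarrow> g \<in> A1 N \<Longrightarrow> Z (f + g) = Z f + Z g"
    and sc: "\<And>c f. f \<in> A1 N \<Longrightarrow> Z (Defs.scale c f) = smult (of_rat c) (Z f)"
    using Z unfolding is_shuffle_reg_def by blast+
  have in_A1: "Defs.scale c (word w) \<in> A1 N" if "w \<in> words1 N" for c w
    using keys_scale[of c "word w"] that by (auto simp: A1_def word_def)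
  \<comment> \<open>Additivity is available only on \<open>A1 N\<close>, so membership of the
    partial sums is proved along with the formula. The value at 0 comes from scaling by 0.\<close>
  have sum: "Z (\<Sum>w\<in>A. Defs.scale (c w) (word w)) = (\<Sum>w\<in>A. smult (of_rat (c w)) (Z (word w))) \<and>
      (\<Sum>w\<in>A. Defs.scale (c w) (word w)) \<in> A1 N" if "finite A" "A \<subseteq> words1 N" for A c
    using that
  proof (induction A rule: finite_induct)
    case empty
    have "Z (Defs.scale 0 0) = smult (of_rat 0) (Z 0)" by (rule sc) (simp add: A1_def)
    moreover have "Defs.scale 0 0 = 0" by (simp add: scale_conv_mult)
    ultimately show ?case by (simp add: A1_def)
  next
    case (insert w A)
    let ?S = "\<Sum>w\<in>A. Defs.scale (c w) (word w)"
    from insert have w: "w \<in> words1 N" and IH: "Z ?S = (\<Sum>w\<in>A. smult (of_rat (c w)) (Z (word w)))"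
      "?S \<in> A1 N" by auto
    have "Defs.scale (c w) (word w) + ?S \<in> A1 N"
      using keys_add[of "Defs.scale (c w) (word w)" ?S] in_A1[OF w] IH(2) by (fastforce simp: A1_def)
    with insert.hyps show ?case
      using w by (simp add: add in_A1 IH sc word_in_A1)
  qed
  have "Z f = Z (\<Sum>w\<in>Poly_Mapping.keys f. Defs.scale (Poly_Mapping.lookup f w) (word w))"
    by (rule arg_cong[OF ncpoly_expand[of f], of Z])
  also have "\<dots> = (\<Sum>w\<in>Poly_Mapping.keys f. smult (of_rat (Poly_Mapping.lookup f w)) (Z (word w)))"
    using sum[of "Poly_Mapping.keys f"] f by (simp add: A1_def)
  finally show ?thesis .
qed

lemma is_shuffle_reg_shuffle_words:
  assumes Z: "is_shuffle_reg N Z" and uv: "u \<in> words1 N" "v \<in> words1 N"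
  shows "shuf_sum (\<lambda>w. Z (word w)) u v = Z (word u) * Z (word v)"
proof -
  have A1: "shuffle_words u v \<in> A1 N"
    using keys_shuffle_words[of u v] shuffles_words1[OF uv] by (auto simp: A1_def)
  have "poly (shuf_sum (\<lambda>w. Z (word w)) u v) T = poly (Z (shuffle_words u v)) T" for T
  proof -
    have "poly (shuf_sum (\<lambda>w. Z (word w)) u v) T = shuf_sum (\<lambda>w. poly (Z (word w)) T) u v"
      by (rule shuf_sum_hom[symmetric]) simp
    also have "\<dots> = lin_ext (\<lambda>w. poly (Z (word w)) T) (shuffle_words u v)"
      by (rule lin_ext_shuffle_words[symmetric])
    also have "\<dots> = poly (Z (shuffle_words u v)) T"
      by (subst is_shuffle_reg_expand[OF Z A1]) (simp add: poly_sum lin_ext_def)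
    finally show ?thesis .
  qed
  then have "shuf_sum (\<lambda>w. Z (word w)) u v = Z (shuffle_words u v)"
    by (simp add: poly_eq_poly_eq_iff[symmetric] fun_eq_iff)
  also have "\<dots> = Z (word u) * Z (word v)"
    using Z uv by (simp add: is_shuffle_reg_def word_in_A1 flip: shuffle_word_word)
  finally show ?thesis .
qed

lemma yindex_in_indices:
  assumes "N \<ge> 1" "w \<in> words1 N"
  shows "yindex w \<in> indices N"
proof -
  have "yindex_from k w \<in> indices N" if "set w \<subseteq> insert 0 (roots_of_unity N)" for k w
    using that by (induction k w rule: yindex_from.induct) (auto simp: indices_def)
  then show ?thesis using assms(2) by (simp add: yindex_def words1_def)
qed

text \<open>The difference from \<open>reg_value\<close> vanishes on convergent words. Both maps are
  shuffle homomorphisms with the same value on \<open>x\<^sub>1\<close>, so the vanishing survives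
  shuffling with \<open>x\<^sub>1\<close>.\<close>

lemma is_shuffle_reg_unique:
  assumes N: "N \<ge> 1" and Z: "is_shuffle_reg N Z" and w: "w \<in> words1 N"
  shows "Z (word w) = reg_value w"
proof -
  have "Z (word w) - reg_value w \<in> {0}"
  proof (rule leading_letter_induct[where S = "words1 N" and a = 1
        and \<phi> = "\<lambda>w. Z (word w) - reg_value w"])
    fix w assume w: "w \<in> words1 N" "w \<noteq> [] \<Longrightarrow> hd w \<noteq> (1::complex)"
    have "yindex w \<in> indices N" "yword (yindex w) = w" "w \<in> words0 N"
      using w N by (auto simp: yindex_in_indices yword_yindex words0_def)
    then show "Z (word w) - reg_value w \<in> {0}"
      using Z reg_value_convergent[OF N, of "yindex w"] by (auto simp: is_shuffle_reg_def)
  next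
    fix w assume w: "w \<in> words1 N" "Z (word w) - reg_value w \<in> {0}"
    have "shuf_sum (\<lambda>w. Z (word w) - reg_value w) [1] w =
        Z (letter 1) * Z (word w) - reg_value [1] * reg_value w"
      using words1_letters[OF N] w(1) one_in_words1
      by (simp add: shuf_sum_diff is_shuffle_reg_shuffle_words[OF Z] reg_value_shuffle letters_def)
    then show "shuf_sum (\<lambda>w. Z (word w) - reg_value w) [1] w \<in> {0}"
      using Z w(2) by (simp add: is_shuffle_reg_def reg_value_1)
  next
    fix n and x :: "complex poly" assume "of_nat (Suc n) * x \<in> {0}"
    then show "x \<in> {0}" by (simp del: of_nat_Suc)
  next
    fix w :: "complex list" assume "1 # w \<in> words1 N"
    then show "w \<in> words1 N" by (auto simp: words1_def split: if_splits)
  next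
    fix u v x :: "complex list" assume "1 # u @ v \<in> words1 N" "x \<in> shuffles [1] v"
    moreover from this(2) have "x \<noteq> []" by auto
    ultimately show "u @ x \<in> words1 N"
      using last_shuffles[of x "[1]" v] by (auto simp: words1_def set_shuffles split: if_splits)
  qed (use w in auto)
  then show ?thesis by simp
qed

lemma zeta_sh_word:
  assumes "N \<ge> 1" "w \<in> words1 N"
  shows "zeta_sh N (word w) = reg_value w"
proof -
  have "is_shuffle_reg N (zeta_sh N)"
    unfolding zeta_sh_def
    by (rule someI[of "is_shuffle_reg N", OF is_shuffle_reg_reg_value[OF assms(1)]])
  then show ?thesis using is_shuffle_reg_unique[of N "zeta_sh N" w] assms by blast
qed

section \<open>Symmetrized values\<close>

lemma split_sum_at_letter_zeros:
  "split_sum (\<lambda>P. at_letter h (R @ P)) (replicate k 0 @ w) =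
     split_sum (\<lambda>P. at_letter h (R @ replicate k 0 @ P)) w"
proof (induction k arbitrary: R)
  case (Suc k)
  show ?case using Suc[of "R @ [0]"] by (simp add: at_letter_def)
qed simp

text \<open>Cuts fall only on nonzero letters: on \<open>c\<close> for j = 0, otherwise on the root
  of the j-th pair. The prepended \<open>c\<close> thus supplies the summand j = 0 of a symmetrized
  value.\<close>

lemma split_sum_at_letter_index:
  assumes "c \<noteq> 0" "\<forall>p\<in>set ps. snd p \<noteq> 0"
  shows "split_sum (at_letter h) (c # yword ps) =
     (\<Sum>j\<le>length ps. h (butlast (c # yword (take j ps))) (last (c # map snd (take j ps))) (yword (drop j ps)))"
  using assms
proof (induction ps arbitrary: c h)
  case Nil
  then show ?case by (simp add: at_letter_def yword_def)
next
  case (Cons p ps)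
  obtain s a where p: "p = (s, a)" by (cases p)
  from Cons.prems have a: "a \<noteq> 0" "\<forall>p\<in>set ps. snd p \<noteq> 0" by (auto simp: p)
  define G where "G j = h (butlast (c # yword (take j (p # ps)))) (last (c # map snd (take j (p # ps))))
      (yword (drop j (p # ps)))" for j
  define h' where "h' = (\<lambda>P. h (c # replicate (s - 1) 0 @ P))"
  have "split_sum (at_letter h) (c # yword (p # ps)) =
      h [] c (yword (p # ps)) + split_sum (\<lambda>P. at_letter h ([c] @ P)) (replicate (s - 1) 0 @ a # yword ps)"
    using Cons.prems(1) by (simp add: p yword_Cons at_letter_def)
  also have "split_sum (\<lambda>P. at_letter h ([c] @ P)) (replicate (s - 1) 0 @ a # yword ps) =
      split_sum (at_letter h') (a # yword ps)"
    unfolding split_sum_at_letter_zeros by (rule split_sum_cong) (simp add: at_letter_def h'_def)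
  also have "\<dots> = (\<Sum>j\<le>length ps. h' (butlast (a # yword (take j ps))) (last (a # map snd (take j ps))) (yword (drop j ps)))"
    by (rule Cons.IH[OF a])
  also have "\<dots> = (\<Sum>j\<le>length ps. G (Suc j))"
    by (rule sum.cong) (auto simp: h'_def G_def p yword_Cons butlast_append)
  also have "h [] c (yword (p # ps)) = G 0" by (simp add: G_def yword_def)
  finally have "split_sum (at_letter h) (c # yword (p # ps)) = (\<Sum>j\<le>length (p # ps). G j)"
    by (simp only: length_Cons sum.atMost_Suc_shift)
  then show ?case by (simp only: G_def)
qed

section \<open>Ratios and partial products of an index\<close>

lemma ratios_from_snoc:
  "ratios_from c (qs @ [(s, a)]) = ratios_from c qs @ [(s, a / last (c # map snd qs))]"
  by (induction qs arbitrary: c) auto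

lemma length_ratios_from [simp]: "length (ratios_from c ps) = length ps"
  by (induction c ps rule: ratios_from.induct) auto

lemma take_ratios_from: "take j (ratios_from c ps) = ratios_from c (take j ps)"
proof (induction c ps arbitrary: j rule: ratios_from.induct)
  case (2 c s a ps)
  then show ?case by (cases j) auto
qed simp

lemma drop_ratios_from:
  "j \<le> length ps \<Longrightarrow> drop j (ratios_from c ps) = ratios_from (last (c # map snd (take j ps))) (drop j ps)"
proof (induction c ps arbitrary: j rule: ratios_from.induct)
  case (2 c s a ps)
  then show ?case by (cases j) auto
qed simp

lemma weight_ratios_from: "weight (ratios_from c ps) = weight ps"
  by (induction c ps rule: ratios_from.induct) (auto simp: weight_def)

lemma length_yword: "\<forall>p\<in>set ps. fst p \<ge> 1 \<Longrightarrow> length (yword ps) = weight ps"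
  by (induction ps) (auto simp: yword_def weight_def)

lemma last_Cons_yword: "last (c # yword ps) = last (c # map snd ps)"
  by (induction ps rule: rev_induct) (auto simp: yword_def)

lemma cnj_norm_1:
  assumes "norm a = 1"
  shows "cnj a = 1 / a"
proof -
  have "a \<noteq> 0" using assms by auto
  moreover have "a * cnj a = 1" using complex_norm_square[of a] assms by simp
  ultimately show ?thesis by (simp add: field_simps)
qed

text \<open>Conjugation inverts the ratios, so their product telescopes.\<close>

lemma prod_cnj_ratios_from:
  assumes "norm c = 1" "\<forall>p\<in>set ps. norm (snd p) = 1"
  shows "(\<Prod>i<length ps. cnj (snd (ratios_from c ps ! i))) = c / last (c # map snd ps)"
  using assms
proof (induction c ps rule: ratios_from.induct)
  case (2 c s a ps)
  have n: "cnj a = 1 / a" "cnj c = 1 / c" "a \<noteq> 0" "c \<noteq> 0"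
    using 2 by (auto simp: cnj_norm_1)
  have "(\<Prod>i<length ((s, a) # ps). cnj (snd (ratios_from c ((s, a) # ps) ! i))) =
      cnj (a / c) * (a / last (a # map snd ps))"
    using 2 by (simp add: prod.lessThan_Suc_shift del: prod.lessThan_Suc)
  also have "cnj (a / c) = c / a" using n by simp
  finally show ?case using n by simp
qed auto

lemma yword_partial_prods_ratios_from:
  "e \<noteq> 0 \<Longrightarrow> \<forall>p\<in>set ps. snd p \<noteq> 0 \<Longrightarrow>
     yword (partial_prods_from d (ratios_from e ps)) = map (\<lambda>x. d * x / e) (yword ps)"
  by (induction e ps arbitrary: d rule: ratios_from.induct) (auto simp: yword_def)

text \<open>Read backwards, the conjugated ratios telescope from the last root, so each exponent is
  now paired with the root preceding it. Dropping the last letter and prepending \<open>c\<close>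
  produces this shift; \<open>d\<close> stays general to absorb the factor of the pair read
  first.\<close>

lemma yword_partial_prods_rev:
  assumes "norm c = 1" "\<forall>p\<in>set ps. norm (snd p) = 1"
  shows "yword (partial_prods_from d (rev (map (\<lambda>(s, a). (s, cnj a)) (ratios_from c ps)))) =
     map (\<lambda>x. d * x / last (c # map snd ps)) (rev (butlast (c # yword ps)))"
  using assms(2)
proof (induction ps arbitrary: d rule: rev_induct)
  case Nil
  show ?case by (simp add: yword_def)
next
  case (snoc p ps)
  obtain s a where p: "p = (s, a)" by (cases p)
  define e where "e = last (c # map snd ps)"
  have "e \<in> insert c (snd ` set ps)" unfolding e_def by (metis last_in_set list.distinct(1) list.set(2) set_map)
  then have e: "norm e = 1" using assms(1) snoc.prems by auto
  have a: "norm a = 1" using snoc.prems by (simp add: p)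
  have n: "cnj a = 1 / a" "cnj e = 1 / e" "a \<noteq> 0" "e \<noteq> 0"
    using a e by (auto simp: cnj_norm_1)
  have IH: "yword (partial_prods_from d (rev (map (\<lambda>(s, a). (s, cnj a)) (ratios_from c ps)))) =
      map (\<lambda>x. d * x / e) (rev (butlast (c # yword ps)))" for d
    unfolding e_def by (rule snoc.IH) (use snoc.prems in simp)
  have "c # yword ps = butlast (c # yword ps) @ [e]"
    unfolding e_def last_Cons_yword[symmetric] by (rule append_butlast_last_id[symmetric]) simp
  then have r: "rev (c # yword ps) = e # rev (butlast (c # yword ps))" by (metis rev_eq_Cons_iff rev_rev_ident rev.simps(2) rev_append)
  have "butlast (c # yword (ps @ [p])) = (c # yword ps) @ replicate (s - 1) 0"
    by (simp add: p yword_append yword_Cons butlast_append) (simp add: yword_def)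
  then have "rev (butlast (c # yword (ps @ [p]))) = replicate (s - 1) 0 @ e # rev (butlast (c # yword ps))"
    using r by simp
  then have right: "map (\<lambda>x. d * x / last (c # map snd (ps @ [p]))) (rev (butlast (c # yword (ps @ [p])))) =
      replicate (s - 1) 0 @ d * e / a # map (\<lambda>x. d * x / a) (rev (butlast (c # yword ps)))"
    by (simp only:) (simp add: p)
  have "rev (map (\<lambda>(s, a). (s, cnj a)) (ratios_from c (ps @ [p]))) =
      (s, cnj (a / e)) # rev (map (\<lambda>(s, a). (s, cnj a)) (ratios_from c ps))"
    by (simp add: p ratios_from_snoc e_def)
  then have "yword (partial_prods_from d (rev (map (\<lambda>(s, a). (s, cnj a)) (ratios_from c (ps @ [p]))))) =
      replicate (s - 1) 0 @ d * cnj (a / e) #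
        map (\<lambda>x. d * cnj (a / e) * x / e) (rev (butlast (c # yword ps)))"
    by (simp only: partial_prods_from.simps yword_Cons IH)
  moreover have "d * cnj (a / e) = d * e / a" using n by simp
  ultimately show ?case
    unfolding right using n by simp
qed

lemma partial_prods_from_indices:
  assumes "N \<ge> 1"
  shows "ps \<in> indices N \<Longrightarrow> d \<in> roots_of_unity N \<Longrightarrow> partial_prods_from d ps \<in> indices N"
  by (induction d ps rule: partial_prods_from.induct)
    (auto simp: indices_def roots_of_unity_def power_mult_distrib)

lemma ratios_from_indices:
  "ps \<in> indices N \<Longrightarrow> c \<in> roots_of_unity N \<Longrightarrow> ratios_from c ps \<in> indices N"
  by (induction c ps rule: ratios_from.induct)
    (auto simp: indices_def roots_of_unity_def power_divide)

lemma yword_in_words1: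
  assumes "N \<ge> 1" "ps \<in> indices N"
  shows "yword ps \<in> words1 N"
proof -
  have "set (yword ps) \<subseteq> insert 0 (roots_of_unity N)"
    using assms(2) by (induction ps) (auto simp: yword_def indices_def)
  then show ?thesis using last_yword[OF assms(2,1)] by (simp add: words1_def)
qed

lemma one_root_of_unity: "1 \<in> roots_of_unity N"
  by (simp add: roots_of_unity_def)

lemma zeta_sh_index_word:
  assumes "N \<ge> 1" "ps \<in> indices N"
  shows "zeta_sh_index N T ps = zeta_word T (yword (partial_prods_from 1 ps))"
proof -
  have "yword (partial_prods_from 1 ps) \<in> words1 N"
    by (intro yword_in_words1 partial_prods_from_indices assms one_root_of_unity)
  then show ?thesis
    by (simp add: zeta_sh_index_def partial_prods_def zeta_sh_word[OF assms(1)] zeta_word_def)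
qed

lemma indices_take: "ps \<in> indices N \<Longrightarrow> take j ps \<in> indices N"
  by (auto simp: indices_def dest: in_set_takeD)

lemma indices_drop: "ps \<in> indices N \<Longrightarrow> drop j ps \<in> indices N"
  by (auto simp: indices_def dest: in_set_dropD)

lemma indices_rev_cnj:
  "ps \<in> indices N \<Longrightarrow> rev (map (\<lambda>(s, a). (s, cnj a)) ps) \<in> indices N"
  by (auto simp: indices_def roots_of_unity_def simp flip: complex_cnj_power)

text \<open>The sums agree term by term: for the j-th cut the prefix gives the reversed conjugate
  index, the suffix the remaining index, and \<open>1 / e j\<close> the product of the
  conjugates.\<close>

lemma zeta_S_index_eq_lie_coeff:
  assumes N: "N \<ge> 1" and ps: "ps \<in> indices N"
  shows "zeta_S_index N T (ratios ps) = lie_coeff T (1 # yword ps)"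
proof -
  have norm: "norm (snd p) = 1" "fst p \<ge> 1" if "p \<in> set ps" for p
    using ps that norm_root_of_unity[OF N] by (auto simp: indices_def)
  have nz: "snd p \<noteq> 0" if "p \<in> set ps" for p
    using norm(1)[OF that] by auto
  have r: "ratios ps \<in> indices N"
    unfolding ratios_def by (rule ratios_from_indices[OF ps one_root_of_unity])
  define e where "e j = last (1 # map snd (take j ps))" for j
  have e: "norm (e j) = 1" "e j \<noteq> 0" for j
  proof -
    have "e j \<in> insert 1 (snd ` set (take j ps))"
      unfolding e_def by (metis last_in_set list.distinct(1) list.set(2) set_map)
    then show "norm (e j) = 1" using norm(1) by (auto dest: in_set_takeD)
    then show "e j \<noteq> 0" by auto
  qed
  have "lie_coeff T (1 # yword ps) = (\<Sum>j\<le>length ps.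
      cut_term T (butlast (1 # yword (take j ps))) (e j) (yword (drop j ps)))"
    unfolding lie_coeff_def e_def using nz by (intro split_sum_at_letter_index) auto
  also have "\<dots> = zeta_S_index N T (ratios ps)"
    unfolding zeta_S_index_def
  proof (rule sum.cong)
    fix j assume "j \<in> {..length (ratios ps)}"
    then have j: "j \<le> length ps" by (simp add: ratios_def)
    have t: "\<forall>p\<in>set (take j ps). norm (snd p) = 1" "\<forall>p\<in>set (take j ps). fst p \<ge> 1"
      using norm by (auto dest: in_set_takeD)
    have d: "\<forall>p\<in>set (drop j ps). snd p \<noteq> 0"
      using nz by (auto dest: in_set_dropD)
    \<comment> \<open>The prepended 1 replaces the dropped last letter, so the prefix has as many
      letters as the weight of the first j pairs.\<close>
    have w: "weight (take j (ratios ps)) = length (butlast (1 # yword (take j ps)))"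
      by (simp only: ratios_def take_ratios_from weight_ratios_from length_butlast list.size
          length_yword[OF t(2)] add_diff_cancel_right')
    have "(\<Prod>i<j. cnj (snd (ratios ps ! i))) =
        (\<Prod>i<length (take j ps). cnj (snd (ratios_from 1 (take j ps) ! i)))"
      using j by (intro prod.cong) (auto simp: ratios_def simp flip: take_ratios_from)
    also have "\<dots> = 1 / e j" unfolding e_def by (rule prod_cnj_ratios_from) (use t in auto)
    finally have p: "(\<Prod>i<j. cnj (snd (ratios ps ! i))) = 1 / e j" .
    have z1: "zeta_sh_index N T (rev (map (\<lambda>(s, \<eta>). (s, cnj \<eta>)) (take j (ratios ps)))) =
        zeta_word T (rescale (e j) (rev (butlast (1 # yword (take j ps)))))"
      using yword_partial_prods_rev[of 1 "take j ps" 1] t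
      by (subst zeta_sh_index_word[OF N indices_rev_cnj[OF indices_take[OF r]]])
        (simp add: ratios_def take_ratios_from rescale_def e_def)
    have z2: "zeta_sh_index N T (drop j (ratios ps)) = zeta_word T (rescale (e j) (yword (drop j ps)))"
      using yword_partial_prods_ratios_from[OF e(2)[of j] d, of 1]
      by (subst zeta_sh_index_word[OF N indices_drop[OF r]])
        (simp add: ratios_def drop_ratios_from[OF j, of 1, folded e_def] rescale_def)
    show "cut_term T (butlast (1 # yword (take j ps))) (e j) (yword (drop j ps)) =
        (- 1) ^ weight (take j (ratios ps)) * (\<Prod>i<j. cnj (snd (ratios ps ! i))) *
        zeta_sh_index N T (rev (map (\<lambda>(s, \<eta>). (s, cnj \<eta>)) (take j (ratios ps)))) *
        zeta_sh_index N T (drop j (ratios ps))"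
      unfolding w p z1 z2 by (simp add: cut_term_def prefix_value_def suffix_value_def)
  qed (simp add: ratios_def)
  finally show ?thesis by simp
qed

section \<open>Passage from words to linear combinations\<close>

lemma zeta_S_eq_lin_ext:
  "zeta_S N T f = lin_ext (\<lambda>w. zeta_S_index N T (ratios (yindex w))) f"
  by (simp add: zeta_S_def lin_ext_def)

lemma words1_mono: "words1 1 \<subseteq> words1 N"
  by (auto simp: words1_def roots_of_unity_def)

lemma words1_append: "u \<in> words1 N \<Longrightarrow> v \<in> words1 N \<Longrightarrow> u @ v \<in> words1 N"
  by (cases "v = []") (auto simp: words1_def)

lemma zeta_S_word_eq_lie_coeff:
  assumes "N \<ge> 1" "w \<in> words1 N"
  shows "zeta_S_index N T (ratios (yindex w)) = lie_coeff T (1 # w)"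
  using zeta_S_index_eq_lie_coeff[OF assms(1) yindex_in_indices[OF assms]] yword_yindex[OF assms(2)]
  by simp

theorem theorem4p11:
  fixes N :: nat and T :: complex and u v :: ncpoly
  assumes "N \<ge> 1" and "u \<in> A1 1" and "v \<in> A1 N"
  shows "zeta_S N T (shuffle u v) = zeta_S N T (tau u * v)"
proof -
  define F where "F = (\<lambda>w. zeta_S_index N T (ratios (yindex w)))"
  have u: "a \<in> words1 1" if "a \<in> Poly_Mapping.keys u" for a
    using that assms(2) by (auto simp: A1_def)
  have v: "b \<in> words1 N" if "b \<in> Poly_Mapping.keys v" for b
    using that assms(3) by (auto simp: A1_def)
  define t where "t a = yword (rev (yindex a))" for a
  \<comment> \<open>\<open>F\<close> is matched with the coefficient of \<open>1 # w\<close> only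
    for w in \<open>words1 N\<close>, as \<open>yindex\<close> forgets trailing zeros; hence the
    membership checks before \<open>lie_coeff_rev\<close> is applied.\<close>
  have word: "shuf_sum F a b = (- 1) ^ weight (yindex a) * F (t a @ b)"
    if "a \<in> Poly_Mapping.keys u" "b \<in> Poly_Mapping.keys v" for a b
  proof -
    have a: "a \<in> words1 1" "a \<in> words1 N" and b: "b \<in> words1 N"
      using u v that words1_mono by auto
    have i: "yindex a \<in> indices 1" by (rule yindex_in_indices[OF _ a(1)]) simp
    have "rev (yindex a) \<in> indices 1" using i by (simp add: indices_def)
    then have "t a \<in> words1 1" unfolding t_def by (intro yword_in_words1) auto
    then have tb: "t a @ b \<in> words1 N" using words1_mono words1_append b by blast
    have "shuf_sum F a b = shuf_sum (\<lambda>w. lie_coeff T (1 # w)) a b"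
      unfolding F_def using shuffles_words1[OF a(2) b] assms(1)
      by (intro shuf_sum_cong zeta_S_word_eq_lie_coeff)
    also have "\<dots> = (- 1) ^ weight (yindex a) * lie_coeff T (1 # t a @ b)"
      using lie_coeff_rev[OF i words1_letters[OF assms(1) b], of T] yword_yindex[OF a(1)]
      by (simp add: t_def)
    also have "lie_coeff T (1 # t a @ b) = F (t a @ b)"
      unfolding F_def by (rule zeta_S_word_eq_lie_coeff[OF assms(1) tb, symmetric])
    finally show ?thesis .
  qed
  have "zeta_S N T (shuffle u v) = (\<Sum>a\<in>Poly_Mapping.keys u. \<Sum>b\<in>Poly_Mapping.keys v.
      of_rat (Poly_Mapping.lookup u a * Poly_Mapping.lookup v b) * ((- 1) ^ weight (yindex a) * F (t a @ b)))"
    unfolding zeta_S_eq_lin_ext F_def[symmetric] lin_ext_shuffle by (simp add: word)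
  also have "\<dots> = (\<Sum>a\<in>Poly_Mapping.keys u. of_rat (Poly_Mapping.lookup u a * (- 1) ^ weight (yindex a)) *
      lin_ext (\<lambda>w. F (t a @ w)) v)"
    by (simp add: lin_ext_def sum_distrib_left of_rat_mult of_rat_power of_rat_minus mult_ac)
  also have "\<dots> = zeta_S N T (tau u * v)"
    unfolding zeta_S_eq_lin_ext F_def[symmetric]
    by (simp add: tau_def sum_distrib_right scale_mult_left lin_ext_sum lin_ext_scale lin_ext_word_mult t_def)
  finally show ?thesis .
qed

end
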